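(* Let $N \geq 3$, $p \in (1,\frac{N}{2})$ and let $E$ be a closed set in $\mathbb{R}^N$ with Assouad dimension $\dim_A(E)=d<\frac{N(N-2p)}{N-p}$. Then, for each $a \in \left(1-\frac{(N-d)(p-1)}{p},\frac{(N-p)(N-d)}{Np}\right)$ there exists $C>0$ such that $$\int_{\mathbb{R}^N} \frac{|u|^p}{\delta_E^{p(a+1)}} \log \left(\delta_E^{N-p-pa} |u|^p\right) dx \leq \frac{N}{p} \log \left(C \int_{\mathbb{R}^N} \frac{|\nabla^2 u|^p}{\delta_E^{(a-1)p}} \, dx \right)$$ for all $u \in C_c^{\infty}(\mathbb{R}^N)$ with $\int_{\mathbb{R}^N} \frac{|u|^p}{\delta_E^{p(a+1)}}\,dx =1$, where $|\nabla^2 u|^2=\sum_{i,j=1}^N \left(\frac{\partial^2 u}{\partial x_i \partial x_j}\right)^2$.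
   Context: For a (nonempty) closed set $E\subset\mathbb{R}^N$, $\delta_E(x)$ denotes the distance from $x$ to $E$. For $E\subset\mathbb{R}^N$, let $\eta(E,r)$ be the minimal number of open balls of radius $r$ with centers in $E$ needed to cover $E$. The Assouad dimension is $$\dim_A(E)= \inf \left\{\lambda \geq 0: \exists\, C_\lambda > 0 \text{ such that } \eta(E \cap B_R(x),r) \leq C_\lambda \left(\tfrac{r}{R} \right)^{-\lambda} \ \forall x \in E,\ 0<r<R< \mathrm{diam}(E) \right\},$$ where, if $\mathrm{diam}(E)=0$, the restriction $R<\mathrm{diam}(E)$ is removed. The convention $0\log 0=0$ is used. *)

theory Defs
  imports "HOL-Analysis.Analysis"
begin

section \<open>Assouad dimension\<close>

text \<open>The infimum over the empty family of covers is \<open>\<infinity>\<close>, so sets without a finite cover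
  get the value \<open>\<infinity>\<close>.\<close>

definition covering_number :: "'a::metric_space set \<Rightarrow> real \<Rightarrow> enat" where
  "covering_number E r =
     (INF F \<in> {F. finite F \<and> F \<subseteq> E \<and> E \<subseteq> (\<Union>c\<in>F. ball c r)}. enat (card F))"

text \<open>The library \<^const>\<open>diameter\<close> is meaningful for bounded sets only.  An unbounded \<open>E\<close> has
  infinite diameter, so \<open>R < diam E\<close> is no restriction there; for \<open>diam E = 0\<close> it is dropped by
  convention.\<close>

definition assouad_admissible :: "'a::metric_space set \<Rightarrow> real \<Rightarrow> bool" where
  "assouad_admissible E l \<longleftrightarrow>
     (\<exists>C>0. \<forall>x\<in>E. \<forall>r R. 0 < r \<and> r < R \<and> (bounded E \<and> diameter E \<noteq> 0 \<longrightarrow> R < diameter E) \<longrightarrow>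
        ereal_of_enat (covering_number (E \<inter> ball x R) r) \<le> ereal (C * (r / R) powr (- l)))"

definition assouad_dim :: "'a::metric_space set \<Rightarrow> ereal" where
  "assouad_dim E = (INF l \<in> {l. 0 \<le> l \<and> assouad_admissible E l}. ereal l)"

section \<open>Smooth compactly supported functions on Euclidean space\<close>

definition partial :: "'n::finite \<Rightarrow> (real^'n \<Rightarrow> real) \<Rightarrow> real^'n \<Rightarrow> real" where
  "partial i u x = deriv (\<lambda>t. u (x + t *\<^sub>R axis i 1)) 0"

definition smooth :: "(real^'n::finite \<Rightarrow> real) \<Rightarrow> bool" where
  "smooth u \<longleftrightarrow>
     (\<forall>is. continuous_on UNIV (foldr partial is u) \<and>
           (\<forall>i x. (\<lambda>t. foldr partial is u (x + t *\<^sub>R axis i 1)) field_differentiable (at 0)))"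

definition test_function :: "(real^'n::finite \<Rightarrow> real) \<Rightarrow> bool" where
  "test_function u \<longleftrightarrow> smooth u \<and> compact (closure {x. u x \<noteq> 0})"

definition hessian_norm :: "(real^'n::finite \<Rightarrow> real) \<Rightarrow> real^'n \<Rightarrow> real" where
  "hessian_norm u x = sqrt (\<Sum>i\<in>UNIV. \<Sum>j\<in>UNIV. (partial i (partial j u) x)\<^sup>2)"

section \<open>Extended-valued integral and logarithm\<close>

text \<open>The Bochner integral is \<open>0\<close> for non-integrable functions.  The logarithmic integral may be
  \<open>-\<infinity>\<close> for some admissible \<open>u\<close>, so the integral of a real function is taken as the
  integral of its positive part minus that of its negative part.  In the library \<open>\<infinity> - \<infinity> = \<infinity>\<close>,
  so an undefined integral never makes an upper bound trivially true.\<close>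

definition ext_integral :: "'a measure \<Rightarrow> ('a \<Rightarrow> real) \<Rightarrow> ereal" where
  "ext_integral M f =
     enn2ereal (\<integral>\<^sup>+x. ennreal (f x) \<partial>M) - enn2ereal (\<integral>\<^sup>+x. ennreal (- f x) \<partial>M)"

definition ext_ln :: "ennreal \<Rightarrow> ereal" where
  "ext_ln x = (if x = 0 then -\<infinity> else if x = \<infinity> then \<infinity> else ereal (ln (enn2real x)))"

end

theory Submission
  imports Defs
begin

text \<open>Write \<open>\<delta>\<close> for the distance to \<open>E\<close> and \<open>q = N p / (N - p)\<close>.  Since \<open>ln t \<le> t / G - 1 + ln G\<close> for all positive
  \<open>t\<close> and \<open>G\<close>, integrating a logarithm against a probability density costs only the logarithm of an
  upper bound \<open>G\<close> for the integral of a power (lemma \<open>ext_integral_mult_ln_le\<close>).  With the power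
  \<open>p / (N - p)\<close> the density \<open>|u|^p / \<delta>^(p (a + 1))\<close> turns into \<open>(|u| \<delta>^(-a))^q\<close>, so the theorem reduces
  to the weighted Sobolev inequality
  \<open>\<integral> (|u| \<delta>^(-a))^q \<le> C (\<integral> |\<nabla>\<^sup>2 u|^p \<delta>^(-(a - 1) p))^(q / p)\<close>.
  The factor \<open>N / p\<close> is the quotient of the two exponents \<open>q / p\<close> and \<open>p / (N - p)\<close>.

  The Sobolev inequality jumps over two derivatives but gains integrability as if there were only one;
  the second order is spent on the power of \<open>\<delta>\<close>.  This makes it easier than the classical
  inequality.  Integrating \<open>t \<phi>''(t)\<close> along rays and averaging over directions gives
  \<open>|u(x)| \<le> C \<integral> |x - y|^(2 - N) |\<nabla>\<^sup>2 u(y)| dy\<close>, and the kernel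
  \<open>\<delta>(x)^(-a) |x - y|^(2 - N) \<delta>(y)^(a - 1)\<close> is bounded from \<open>L^p\<close> to \<open>L^q\<close> by a single application
  of Hoelder's inequality with three factors (lemma \<open>Schur_test\<close>): near the diagonal
  the kernel is about \<open>\<delta>(x)^(-1) |x - y|^(2 - N)\<close>, less singular than the critical
  \<open>|x - y|^(1 - N)\<close>, and away from the
  diagonal a small power of \<open>\<delta>\<close> can be shifted from one factor to the other to make
  all integrals converge.

  The only geometric input is that \<open>\<delta>^(-\<beta>)\<close> integrates over a ball of radius \<open>r\<close>, whose centre has distance at most
  \<open>r\<close> from \<open>E\<close>, to at most \<open>C r^(N - \<beta>)\<close> whenever \<open>\<beta> < N - dim E\<close> (lemma \<open>ball_infdist_weight_bound\<close>).
  The two bounds on \<open>a\<close> say exactly that the exponents \<open>a q\<close> and \<open>(1 - a) p / (p - 1)\<close>, which arise from the two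
  sides of the kernel, are below \<open>N - dim E\<close>.\<close>

section \<open>Coverings and the volume of tubes\<close>

lemma covering_number_le_realD:
  assumes "ereal_of_enat (covering_number E r) \<le> ereal b"
  obtains F where "finite F" "F \<subseteq> E" "E \<subseteq> (\<Union>c\<in>F. ball c r)" "real (card F) \<le> b"
proof -
  let ?A = "(\<lambda>F. enat (card F)) ` {F. finite F \<and> F \<subseteq> E \<and> E \<subseteq> (\<Union>c\<in>F. ball c r)}"
  have "?A \<noteq> {}"
  proof
    assume "?A = {}"
    then have "covering_number E r = \<infinity>"
      unfolding covering_number_def Inf_enat_def by (simp only: refl if_True)
    with assms show False by simp
  qed
  then obtain k where "k \<in> ?A" by blast
  then have "Inf ?A \<in> ?A"
    using LeastI[of "\<lambda>x. x \<in> ?A" k] \<open>?A \<noteq> {}\<close> by (simp only: Inf_enat_def if_False)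
  then obtain F where F: "finite F" "F \<subseteq> E" "E \<subseteq> (\<Union>c\<in>F. ball c r)" "Inf ?A = enat (card F)"
    by blast
  from assms F(4) have "real (card F) \<le> b"
    unfolding covering_number_def by (simp add: ereal_of_enat_simps)
  with F that show thesis by blast
qed

text \<open>In a bounded set of positive diameter \<open>D\<close>, admissibility controls only radii \<open>R < D\<close>.  Larger \<open>R\<close> cost a
  constant factor, since by compactness a fixed number of balls of radius \<open>D / 2\<close> covers the whole set.\<close>

lemma assouad_admissible_covers:
  fixes E :: "'a::euclidean_space set"
  assumes adm: "assouad_admissible E l" and "closed E" "0 \<le> l"
  obtains C where "C > 0" and "\<And>x r R. x \<in> E \<Longrightarrow> 0 < r \<Longrightarrow> r < R \<Longrightarrow>
    \<exists>F. finite F \<and> real (card F) \<le> C * (r / R) powr (-l) \<and> E \<inter> ball x R \<subseteq> (\<Union>c\<in>F. ball c r)"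
proof -
  obtain C where C: "C > 0" and
    cov: "\<And>x r R. x \<in> E \<Longrightarrow> 0 < r \<Longrightarrow> r < R \<Longrightarrow> (bounded E \<and> diameter E \<noteq> 0 \<longrightarrow> R < diameter E)
      \<Longrightarrow> ereal_of_enat (covering_number (E \<inter> ball x R) r) \<le> ereal (C * (r / R) powr (- l))"
    using adm unfolding assouad_admissible_def by blast
  have cov: "\<exists>F. finite F \<and> real (card F) \<le> C * (r / R) powr (-l) \<and> E \<inter> ball x R \<subseteq> (\<Union>c\<in>F. ball c r)"
    if "x \<in> E" "0 < r" "r < R" "bounded E \<and> diameter E \<noteq> 0 \<longrightarrow> R < diameter E" for x r R
    using covering_number_le_realD[OF cov[OF that]] by metis
  show thesis
  proof (cases "bounded E \<and> diameter E \<noteq> 0")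
    case False
    with cov C that show thesis by blast
  next
    case True
    define D where "D = diameter E"
    have D: "D > 0"
      using True diameter_ge_0[of E] by (auto simp: D_def)
    have "compact E" using True \<open>closed E\<close> by (simp add: compact_eq_bounded_closed)
    have "E \<subseteq> (\<Union>c\<in>E. ball c (D/2))" using D by auto
    then obtain F0 where F0: "F0 \<subseteq> E" "finite F0" "E \<subseteq> (\<Union>c\<in>F0. ball c (D/2))"
      using compactE_image[OF \<open>compact E\<close>, of E "\<lambda>c. ball c (D/2)"] by blast
    define m where "m = real (card F0) + 1"
    show thesis
    proof (rule that[of "m * (C + 1)"])
      show "m * (C + 1) > 0" using C by (simp add: m_def add_nonneg_pos)
      fix x :: 'a and r R :: real assume x: "x \<in> E" and r: "0 < r" "r < R"
      have Cm: "C \<le> m * (C + 1)" "m \<le> m * (C + 1)"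
        using C by (auto simp: m_def algebra_simps)
      consider "R < D" | "R \<ge> D" "r < D/2" | "r \<ge> D / 2" "R \<ge> D" by linarith
      then show "\<exists>F. finite F \<and> real (card F) \<le> m * (C + 1) * (r / R) powr (-l)
          \<and> E \<inter> ball x R \<subseteq> (\<Union>c\<in>F. ball c r)"
      proof cases
        case 1
        then obtain F where F: "finite F" "real (card F) \<le> C * (r / R) powr (-l)"
          "E \<inter> ball x R \<subseteq> (\<Union>c\<in>F. ball c r)"
          using cov[of x r R] x r unfolding D_def by blast
        have "C * (r / R) powr (-l) \<le> m * (C + 1) * (r / R) powr (-l)"
          using Cm by (intro mult_right_mono) auto
        with F show ?thesis by (meson order.trans)
      next
        case 2
        have "\<forall>c\<in>F0. \<exists>F. finite F \<and> real (card F) \<le> C * (r / (D/2)) powr (-l)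
            \<and> E \<inter> ball c (D/2) \<subseteq> (\<Union>c\<in>F. ball c r)"
          using cov[of _ r "D/2"] 2 r F0 D unfolding D_def by auto
        then obtain G where G: "\<And>c. c \<in> F0 \<Longrightarrow> finite (G c) \<and> real (card (G c)) \<le> C * (r / (D/2)) powr (-l)
            \<and> E \<inter> ball c (D/2) \<subseteq> (\<Union>c\<in>G c. ball c r)"
          by metis
        have "r / R \<le> r / (D/2)"
          using 2 r D by (intro divide_left_mono) auto
        then have le: "(r / (D/2)) powr (-l) \<le> (r / R) powr (-l)"
          using 2 r D \<open>0 \<le> l\<close> by (intro powr_mono2') auto
        have "real (card (\<Union>c\<in>F0. G c)) \<le> (\<Sum>c\<in>F0. real (card (G c)))"
          using card_UN_le[OF F0(2), of G] by (metis of_nat_le_iff of_nat_sum)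
        also have "\<dots> \<le> (\<Sum>c\<in>F0. C * (r / R) powr (-l))"
          using G le C by (intro sum_mono order.trans[OF conjunct1[OF conjunct2[OF G]]] mult_left_mono) auto
        also have "\<dots> = real (card F0) * C * (r / R) powr (-l)" by simp
        also have "\<dots> \<le> m * (C + 1) * (r / R) powr (-l)"
          using C by (intro mult_right_mono mult_mono) (auto simp: m_def)
        finally have "real (card (\<Union>c\<in>F0. G c)) \<le> m * (C + 1) * (r / R) powr (-l)" .
        moreover have "E \<inter> ball x R \<subseteq> (\<Union>c\<in>(\<Union>c\<in>F0. G c). ball c r)"
          using F0(3) G by blast
        moreover have "finite (\<Union>c\<in>F0. G c)" using F0 G by blast
        ultimately show ?thesis by blast
      next
        case 3
        have "1 \<le> (r / R) powr (-l)"
          using r \<open>0 \<le> l\<close> powr_mono2'[of "-l" "r/R" 1] by (simp add: divide_le_eq_1)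
        then have "m * 1 \<le> m * (C + 1) * (r / R) powr (-l)"
          using C by (intro mult_mono[OF Cm(2)]) (auto simp: m_def)
        moreover have "real (card F0) \<le> m" by (simp add: m_def)
        ultimately have "real (card F0) \<le> m * (C + 1) * (r / R) powr (-l)" by linarith
        moreover have "E \<inter> ball x R \<subseteq> (\<Union>c\<in>F0. ball c r)"
          using F0(3) 3 by (force simp: subset_iff)
        ultimately show ?thesis using F0(2) by blast
      qed
    qed
  qed
qed

text \<open>Doubling the radii of a covering of \<open>E\<close> by balls of radius \<open>\<rho>\<close> covers the points at distance less than
  \<open>\<rho>\<close> from \<open>E\<close>; there are at most \<open>C (r / \<rho>)^l\<close> balls, each of volume comparable to \<open>\<rho>\<close> to the dimension.\<close>

lemma tube_volume_bound:
  fixes E :: "'a::euclidean_space set"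
  assumes adm: "assouad_admissible E l" and "closed E" "0 \<le> l"
  obtains C where "C > 0" and "\<And>w r \<rho>. w \<in> E \<Longrightarrow> 0 < \<rho> \<Longrightarrow> \<rho> \<le> r \<Longrightarrow>
    emeasure lborel {x \<in> ball w r. infdist x E < \<rho>}
      \<le> ennreal (C * r powr l * \<rho> powr (real DIM('a) - l))"
proof -
  obtain C where C: "C > 0" and cov: "\<And>x r R. x \<in> E \<Longrightarrow> 0 < r \<Longrightarrow> r < R \<Longrightarrow>
    \<exists>F. finite F \<and> real (card F) \<le> C * (r / R) powr (-l) \<and> E \<inter> ball x R \<subseteq> (\<Union>c\<in>F. ball c r)"
    by (rule assouad_admissible_covers[OF assms]) blast
  let ?n = "DIM('a)"
  define V where "V = unit_ball_vol (real ?n) * 2 ^ ?n"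
  have V: "V > 0" by (simp add: V_def)
  show thesis
  proof (rule that[of "C * 2 powr l * V"])
    show "C * 2 powr l * V > 0" using C V by simp
    fix w :: 'a and r \<rho> :: real assume w: "w \<in> E" and \<rho>: "0 < \<rho>" "\<rho> \<le> r"
    obtain F where F: "finite F" "real (card F) \<le> C * (\<rho> / (2*r)) powr (-l)"
      "E \<inter> ball w (2*r) \<subseteq> (\<Union>c\<in>F. ball c \<rho>)"
      using cov[OF w, of \<rho> "2*r"] \<rho> by auto
    have sub: "{x \<in> ball w r. infdist x E < \<rho>} \<subseteq> (\<Union>c\<in>F. ball c (2*\<rho>))"
    proof
      fix x assume x: "x \<in> {x \<in> ball w r. infdist x E < \<rho>}"
      obtain e where e: "e \<in> E" "infdist x E = dist x e"
        using infdist_attains_inf[OF \<open>closed E\<close>, of x] w by blast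
      have "dist w e < 2 * r"
        using dist_triangle[of w e x] x e \<rho> by auto
      then obtain c where c: "c \<in> F" "dist c e < \<rho>" using F(3) e by auto
      have "dist c x < 2 * \<rho>"
        using dist_triangle[of c x e] x e c by (auto simp: dist_commute)
      with c show "x \<in> (\<Union>c\<in>F. ball c (2*\<rho>))" by auto
    qed
    have "emeasure lborel {x \<in> ball w r. infdist x E < \<rho>} \<le> emeasure lborel (\<Union>c\<in>F. ball c (2*\<rho>))"
      using sub by (intro emeasure_mono) (simp_all add: F(1) sets.finite_UN)
    also have "\<dots> \<le> (\<Sum>c\<in>F. emeasure lborel (ball c (2*\<rho>)))"
      using F(1) by (intro emeasure_subadditive_finite) auto
    also have "\<dots> = (\<Sum>c\<in>F. ennreal (V * \<rho> ^ ?n))"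
      using \<rho> by (intro sum.cong) (auto simp: emeasure_ball V_def power_mult_distrib mult_ac)
    also have "\<dots> = ennreal (real (card F) * (V * \<rho> ^ ?n))"
      by (simp add: ennreal_mult' ennreal_of_nat_eq_real_of_nat)
    also have "\<dots> \<le> ennreal (C * (\<rho> / (2*r)) powr (-l) * (V * \<rho> ^ ?n))"
      using F(2) V \<rho> by (intro ennreal_leI mult_right_mono) auto
    also have "C * (\<rho> / (2*r)) powr (-l) * (V * \<rho> ^ ?n)
        = C * 2 powr l * V * r powr l * \<rho> powr (real ?n - l)"
      using \<rho> by (simp add: powr_divide powr_mult powr_minus powr_diff powr_realpow field_simps)
    finally show "emeasure lborel {x \<in> ball w r. infdist x E < \<rho>}
      \<le> ennreal (C * 2 powr l * V * r powr l * \<rho> powr (real ?n - l))" .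
  qed
qed

section \<open>Integrals of powers by dyadic decomposition\<close>

text \<open>On each shell \<open>h\<close> is comparable to \<open>r b^k\<close>, so the integral is dominated by a geometric series of
  ratio \<open>b^(\<kappa> - \<beta>)\<close>.  The base \<open>b = 1/2\<close> treats a singularity of the weight at \<open>h = 0\<close>, the base \<open>b = 2\<close>
  its decay at infinity.\<close>

lemma dyadic_nn_integral_bound:
  fixes h :: "'a \<Rightarrow> real"
  assumes [measurable]: "h \<in> borel_measurable M" "S \<in> sets M"
    and pos: "\<And>x. x \<in> S \<Longrightarrow> h x > 0" and r: "r > 0" and b: "b > 0" and A: "A \<ge> 0"
    and shell: "\<And>x. x \<in> S \<Longrightarrow> \<exists>k::nat. r * b ^ k / 2 \<le> h x \<and> h x \<le> r * b ^ k"
    and vol: "\<And>k::nat. emeasure M {x \<in> S. r * b ^ k / 2 \<le> h x \<and> h x \<le> r * b ^ k} \<le> ennreal (A * (r * b ^ k) powr \<kappa>)"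
    and conv: "b powr (\<kappa> - \<beta>) < 1"
  shows "(\<integral>\<^sup>+x\<in>S. ennreal (h x powr (-\<beta>)) \<partial>M)
    \<le> ennreal (2 powr \<bar>\<beta>\<bar> / (1 - b powr (\<kappa> - \<beta>)) * A * r powr (\<kappa> - \<beta>))"
proof -
  define T where "T k = {x \<in> S. r * b ^ k / 2 \<le> h x \<and> h x \<le> r * b ^ k}" for k :: nat
  define c where "c k = 2 powr \<bar>\<beta>\<bar> * (r * b ^ k) powr (-\<beta>)" for k :: nat
  have [measurable]: "T k \<in> sets M" for k unfolding T_def by measurable
  have rb: "r * b ^ k > 0" for k using r b by simp
  have le_c: "h x powr (-\<beta>) \<le> c k" if "x \<in> T k" for x k
  proof (cases "\<beta> \<ge> 0")
    case True
    have "h x powr (-\<beta>) \<le> (r * b ^ k / 2) powr (-\<beta>)"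
      using that True rb[of k] by (intro powr_mono2') (auto simp: T_def)
    also have "\<dots> = c k" using True rb[of k] unfolding c_def
      by (subst powr_divide) (auto simp: powr_minus field_simps)
    finally show ?thesis .
  next
    case False
    have "h x powr (-\<beta>) \<le> (r * b ^ k) powr (-\<beta>)"
      using that False pos[of x] by (intro powr_mono2) (auto simp: T_def less_imp_le)
    also have "\<dots> \<le> c k"
      unfolding c_def using ge_one_powr_ge_zero[of 2 "\<bar>\<beta>\<bar>"] by (simp add: mult_le_cancel_right1)
    finally show ?thesis .
  qed
  have "ennreal (h x powr (-\<beta>)) * indicator S x \<le> (\<Sum>k. ennreal (c k) * indicator (T k) x)" for x
  proof (cases "x \<in> S")
    case True
    then obtain k where k: "x \<in> T k" using shell by (auto simp: T_def)
    have "ennreal (h x powr (-\<beta>)) * indicator S x \<le> ennreal (c k) * indicator (T k) x"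
      using k True le_c[OF k] by (auto intro: ennreal_leI)
    also have "\<dots> \<le> (\<Sum>k. ennreal (c k) * indicator (T k) x)"
      using sum_le_suminf[of "\<lambda>k. ennreal (c k) * indicator (T k) x" "{k}"]
      by (simp only: sum.insert finite.emptyI empty_iff not_False_eq_True sum.empty add_0_right) simp
    finally show ?thesis .
  qed simp
  then have "(\<integral>\<^sup>+x\<in>S. ennreal (h x powr (-\<beta>)) \<partial>M)
      \<le> (\<integral>\<^sup>+x. (\<Sum>k. ennreal (c k) * indicator (T k) x) \<partial>M)"
    by (intro nn_integral_mono) auto
  also have "\<dots> = (\<Sum>k. ennreal (c k) * emeasure M (T k))"
    by (subst nn_integral_suminf) (auto simp: nn_integral_cmult_indicator)
  also have "\<dots> \<le> (\<Sum>k. ennreal (2 powr \<bar>\<beta>\<bar> * A * r powr (\<kappa> - \<beta>) * (b powr (\<kappa> - \<beta>)) ^ k))"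
  proof (intro suminf_le)
    fix k
    have "ennreal (c k) * emeasure M (T k) \<le> ennreal (c k) * ennreal (A * (r * b ^ k) powr \<kappa>)"
      using vol unfolding T_def by (intro mult_left_mono) auto
    also have "\<dots> = ennreal (c k * (A * (r * b ^ k) powr \<kappa>))"
      using A by (intro ennreal_mult[symmetric]) (auto simp: c_def)
    also have "c k * (A * (r * b ^ k) powr \<kappa>) = 2 powr \<bar>\<beta>\<bar> * A * (r * b ^ k) powr (\<kappa> - \<beta>)"
      using rb[of k] by (simp add: c_def powr_diff powr_minus field_simps)
    also have "(r * b ^ k) powr (\<kappa> - \<beta>) = r powr (\<kappa> - \<beta>) * (b powr (\<kappa> - \<beta>)) ^ k"
      using r b by (simp add: powr_mult powr_powr mult.commute flip: powr_realpow)
    finally show "ennreal (c k) * emeasure M (T k)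
       \<le> ennreal (2 powr \<bar>\<beta>\<bar> * A * r powr (\<kappa> - \<beta>) * (b powr (\<kappa> - \<beta>)) ^ k)"
      by (simp add: mult_ac)
  qed auto
  also have "\<dots> = ennreal (\<Sum>k. 2 powr \<bar>\<beta>\<bar> * A * r powr (\<kappa> - \<beta>) * (b powr (\<kappa> - \<beta>)) ^ k)"
    using A conv by (intro suminf_ennreal2) (auto intro!: summable_mult summable_geometric)
  also have "(\<Sum>k. 2 powr \<bar>\<beta>\<bar> * A * r powr (\<kappa> - \<beta>) * (b powr (\<kappa> - \<beta>)) ^ k)
     = 2 powr \<bar>\<beta>\<bar> / (1 - b powr (\<kappa> - \<beta>)) * A * r powr (\<kappa> - \<beta>)"
    using conv by (subst suminf_mult) (auto simp: suminf_geometric summable_geometric)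
  finally show ?thesis .
qed

lemma ex_dyadic_shell_down:
  fixes t r :: real
  assumes "0 < t" "t \<le> r"
  shows "\<exists>k::nat. r * (1/2) ^ k / 2 \<le> t \<and> t \<le> r * (1/2) ^ k"
proof -
  let ?P = "\<lambda>k::nat. r * (1/2) ^ k \<le> 2 * t"
  have "\<exists>k. ?P k"
  proof -
    obtain k where "(1/2::real) ^ k < 2 * t / r"
      using real_arch_pow_inv[of "2 * t / r" "1/2"] assms by auto
    then show ?thesis using assms by (intro exI[of _ k]) (auto simp: field_simps)
  qed
  then have L: "?P (LEAST k. ?P k)" by (rule LeastI_ex)
  have "t \<le> r * (1/2) ^ (LEAST k. ?P k)"
  proof (cases "LEAST k. ?P k")
    case 0
    then show ?thesis using assms by simp
  next
    case (Suc j)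
    then have "\<not> ?P j" by (metis lessI not_less_Least)
    then show ?thesis using Suc by simp
  qed
  with L show ?thesis by (intro exI[of _ "LEAST k. ?P k"]) auto
qed

lemma ex_dyadic_shell_up:
  fixes t r :: real
  assumes "0 < r" "r \<le> 2 * t"
  shows "\<exists>k::nat. r * 2 ^ k / 2 \<le> t \<and> t \<le> r * 2 ^ k"
proof -
  let ?P = "\<lambda>k::nat. t \<le> r * 2 ^ k"
  have "\<exists>k. ?P k"
  proof -
    obtain k where "t / r < 2 ^ k"
      using real_arch_pow[of 2 "t / r"] by auto
    then show ?thesis using assms by (intro exI[of _ k]) (auto simp: field_simps)
  qed
  then have L: "?P (LEAST k. ?P k)" by (rule LeastI_ex)
  have "r * 2 ^ (LEAST k. ?P k) / 2 \<le> t"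
  proof (cases "LEAST k. ?P k")
    case 0
    then show ?thesis using assms by simp
  next
    case (Suc j)
    then have "\<not> ?P j" by (metis lessI not_less_Least)
    then show ?thesis using Suc by simp
  qed
  with L show ?thesis by blast
qed

section \<open>Powers of the distance to a set\<close>

lemma borel_measurable_infdist [measurable]: "(\<lambda>x. infdist x E) \<in> borel_measurable borel"
  by (intro borel_measurable_continuous_onI continuous_intros)

lemma infdist_pos_iff:
  fixes E :: "'a::metric_space set"
  assumes "closed E" "E \<noteq> {}"
  shows "infdist x E > 0 \<longleftrightarrow> x \<notin> E"
  using in_closed_iff_infdist_zero[OF assms, of x] infdist_nonneg[of x E] by linarith

text \<open>The ball lies in a ball of radius \<open>2 r\<close> around a point of \<open>E\<close>, where the volume of tubes decides about
  integrability of the weight: the shell \<open>\<delta> \<approx> t\<close> has volume at most \<open>C r^l t^(N - l)\<close>.\<close>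

lemma ball_infdist_weight_bound:
  fixes E :: "'a::euclidean_space set"
  assumes adm: "assouad_admissible E l" and E: "closed E" "E \<noteq> {}" and l: "0 \<le> l"
    and \<beta>: "\<beta> < real DIM('a) - l"
  obtains C where "C > 0" and "\<And>z r. 0 < r \<Longrightarrow> infdist z E \<le> r \<Longrightarrow>
    (\<integral>\<^sup>+x\<in>ball z r - E. ennreal (infdist x E powr (-\<beta>)) \<partial>lborel)
      \<le> ennreal (C * r powr (real DIM('a) - \<beta>))"
proof -
  obtain C where C: "C > 0" and tube: "\<And>w r \<rho>. w \<in> E \<Longrightarrow> 0 < \<rho> \<Longrightarrow> \<rho> \<le> r \<Longrightarrow>
    emeasure lborel {x \<in> ball w r. infdist x E < \<rho>}
      \<le> ennreal (C * r powr l * \<rho> powr (real DIM('a) - l))"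
    by (rule tube_volume_bound[OF adm E(1) l]) blast
  define n where "n = real DIM('a)"
  define D where "D = 2 powr \<bar>\<beta>\<bar> / (1 - (1/2) powr (n - l - \<beta>)) * (C * 2 powr n)"
  have small: "(1/2) powr (n - l - \<beta>) < (1::real)"
    using \<beta> powr_less_mono2[of "n - l - \<beta>" "1/2" 1] by (simp add: n_def)
  have D: "D > 0" using C small unfolding D_def by (intro mult_pos_pos divide_pos_pos) auto
  show thesis
  proof (rule that[of "D * 2 powr (n - \<beta>)"])
    show "D * 2 powr (n - \<beta>) > 0" using D by simp
    fix z :: 'a and r :: real assume r: "0 < r" "infdist z E \<le> r"
    obtain w where w: "w \<in> E" "infdist z E = dist z w"
      using infdist_attains_inf[OF E] by blast
    define R where "R = 2 * r"
    have R: "R > 0" using r by (simp add: R_def)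
    have sub: "ball z r - E \<subseteq> ball w R - E"
    proof
      fix x assume x: "x \<in> ball z r - E"
      have "dist w x < R"
        using dist_triangle[of w x z] x r w by (simp add: R_def dist_commute)
      with x show "x \<in> ball w R - E" by simp
    qed
    have "(\<integral>\<^sup>+x\<in>ball z r - E. ennreal (infdist x E powr (-\<beta>)) \<partial>lborel)
      \<le> (\<integral>\<^sup>+x\<in>ball w R - E. ennreal (infdist x E powr (-\<beta>)) \<partial>lborel)"
      using sub by (intro nn_integral_mono mult_left_mono) (auto split: split_indicator)
    also have "\<dots> \<le> ennreal (2 powr \<bar>\<beta>\<bar> / (1 - (1/2) powr (n - l - \<beta>)) * (C * 2 powr n * R powr l) * R powr (n - l - \<beta>))"
    proof (rule dyadic_nn_integral_bound)
      show "ball w R - E \<in> sets lborel" using E by simp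
      show "infdist x E > 0" if "x \<in> ball w R - E" for x
        using that E by (simp add: infdist_pos_iff)
      show "\<exists>k::nat. R * (1/2) ^ k / 2 \<le> infdist x E \<and> infdist x E \<le> R * (1/2) ^ k"
        if "x \<in> ball w R - E" for x
      proof (rule ex_dyadic_shell_down)
        show "infdist x E > 0" using that E by (simp add: infdist_pos_iff)
        show "infdist x E \<le> R"
          using that infdist_le[OF w(1), of x] by (simp add: dist_commute)
      qed
      fix k :: nat
      define t where "t = R * (1/2) ^ k"
      have t: "t > 0" "t \<le> R" using R by (auto simp: t_def mult_le_cancel_left1 power_le_one)
      have "{x \<in> ball w R - E. t / 2 \<le> infdist x E \<and> infdist x E \<le> t}
          \<subseteq> {x \<in> ball w (2*R). infdist x E < 2*t}"
        using t R by auto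
      then have "emeasure lborel {x \<in> ball w R - E. t / 2 \<le> infdist x E \<and> infdist x E \<le> t}
        \<le> emeasure lborel {x \<in> ball w (2*R). infdist x E < 2*t}"
        by (intro emeasure_mono) auto
      also have "\<dots> \<le> ennreal (C * (2*R) powr l * (2*t) powr (real DIM('a) - l))"
        using t by (intro tube w) auto
      also have "C * (2*R) powr l * (2*t) powr (real DIM('a) - l) = C * 2 powr n * R powr l * t powr (n - l)"
        using t R by (simp add: powr_mult powr_diff n_def)
      finally show "emeasure lborel {x \<in> ball w R - E. R * (1/2) ^ k / 2 \<le> infdist x E \<and> infdist x E \<le> R * (1/2) ^ k}
        \<le> ennreal (C * 2 powr n * R powr l * (R * (1/2) ^ k) powr (n - l))"
        unfolding t_def .
    qed (use R C small in auto)
    also have "2 powr \<bar>\<beta>\<bar> / (1 - (1/2) powr (n - l - \<beta>)) * (C * 2 powr n * R powr l) * R powr (n - l - \<beta>)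
        = D * R powr (n - \<beta>)"
      using R by (simp add: D_def powr_diff)
    also have "D * R powr (n - \<beta>) = D * 2 powr (n - \<beta>) * r powr (real DIM('a) - \<beta>)"
      using r by (simp add: R_def powr_mult n_def)
    finally show "(\<integral>\<^sup>+x\<in>ball z r - E. ennreal (infdist x E powr (-\<beta>)) \<partial>lborel)
      \<le> ennreal (D * 2 powr (n - \<beta>) * r powr (real DIM('a) - \<beta>))" .
  qed
qed

text \<open>The part of \<open>E\<close> in a ball lies in tubes of arbitrarily small volume.\<close>

lemma assouad_admissible_null_set:
  fixes E :: "'a::euclidean_space set"
  assumes adm: "assouad_admissible E l" and E: "closed E" "E \<noteq> {}" and l: "0 \<le> l" "l < real DIM('a)"
  shows "E \<in> null_sets lborel"
proof -
  obtain w where w: "w \<in> E" using E by blast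
  obtain C where C: "C > 0" and tube: "\<And>w r \<rho>. w \<in> E \<Longrightarrow> 0 < \<rho> \<Longrightarrow> \<rho> \<le> r \<Longrightarrow>
    emeasure lborel {x \<in> ball w r. infdist x E < \<rho>}
      \<le> ennreal (C * r powr l * \<rho> powr (real DIM('a) - l))"
    by (rule tube_volume_bound[OF adm E(1) l(1)]) blast
  have "E \<inter> ball w (real (Suc k)) \<in> null_sets lborel" for k
  proof -
    define r where "r = real (Suc k)"
    have r: "r > 0" by (simp add: r_def)
    have small: "emeasure lborel (E \<inter> ball w r) \<le> ennreal e" if e: "e > 0" for e
    proof -
      define K where "K = C * r powr l"
      have K: "K > 0" using C r by (simp add: K_def)
      define \<rho> where "\<rho> = min r ((e / K) powr (1 / (real DIM('a) - l)))"
      have \<rho>: "0 < \<rho>" "\<rho> \<le> r" using r e K by (auto simp: \<rho>_def)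
      have "\<rho> powr (real DIM('a) - l) \<le> ((e / K) powr (1 / (real DIM('a) - l))) powr (real DIM('a) - l)"
        using l \<rho> by (intro powr_mono2) (auto simp: \<rho>_def)
      also have "\<dots> = e / K" using e K l by (simp add: powr_powr)
      finally have *: "K * \<rho> powr (real DIM('a) - l) \<le> e" using K by (simp add: field_simps)
      have "emeasure lborel (E \<inter> ball w r) \<le> emeasure lborel {x \<in> ball w r. infdist x E < \<rho>}"
        using \<rho> by (intro emeasure_mono) auto
      also have "\<dots> \<le> ennreal (C * r powr l * \<rho> powr (real DIM('a) - l))"
        using tube[OF w \<rho>] .
      also have "\<dots> \<le> ennreal e" using * by (intro ennreal_leI) (simp add: K_def)
      finally show ?thesis .
    qed
    have "emeasure lborel (E \<inter> ball w r) \<le> 0"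
    proof (rule ennreal_le_epsilon)
      fix e :: real assume "0 < e"
      from small[OF this] show "emeasure lborel (E \<inter> ball w r) \<le> 0 + ennreal e" by simp
    qed
    then show ?thesis using E by (auto simp: r_def)
  qed
  then have "(\<Union>k. E \<inter> ball w (real (Suc k))) \<in> null_sets lborel"
    by (rule null_sets_UN)
  also have "(\<Union>k. E \<inter> ball w (real (Suc k))) = E"
  proof safe
    fix x assume "x \<in> E"
    obtain k where "dist w x < real k" using reals_Archimedean2 by blast
    with \<open>x \<in> E\<close> show "x \<in> (\<Union>k. E \<inter> ball w (real (Suc k)))" by (auto intro!: exI[of _ k])
  qed
  finally show ?thesis .
qed

lemma ball_dist_weight_bound:
  fixes z :: "'a::euclidean_space"
  assumes s: "s < real DIM('a)" and r: "r > 0"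
  shows "(\<integral>\<^sup>+x\<in>ball z r - {z}. ennreal (dist x z powr (-s)) \<partial>lborel)
      \<le> ennreal (2 powr \<bar>s\<bar> / (1 - (1/2) powr (real DIM('a) - s)) * unit_ball_vol (real DIM('a)) * r powr (real DIM('a) - s))"
proof (rule dyadic_nn_integral_bound)
  show "\<exists>k::nat. r * (1/2) ^ k / 2 \<le> dist x z \<and> dist x z \<le> r * (1/2) ^ k"
    if "x \<in> ball z r - {z}" for x
    using that by (intro ex_dyadic_shell_down) (auto simp: dist_commute)
  show "(1/2) powr (real DIM('a) - s) < (1::real)"
    using s powr_less_mono2[of "real DIM('a) - s" "1/2" 1] by simp
  fix k :: nat
  have "emeasure lborel {x \<in> ball z r - {z}. r * (1/2) ^ k / 2 \<le> dist x z \<and> dist x z \<le> r * (1/2) ^ k}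
     \<le> emeasure lborel (cball z (r * (1/2) ^ k))"
    by (intro emeasure_mono) (auto simp: dist_commute)
  also have "\<dots> = ennreal (unit_ball_vol (real DIM('a)) * (r * (1/2) ^ k) powr real DIM('a))"
    using r by (subst emeasure_cball) (auto simp: powr_realpow)
  finally show "emeasure lborel {x \<in> ball z r - {z}. r * (1/2) ^ k / 2 \<le> dist x z \<and> dist x z \<le> r * (1/2) ^ k}
     \<le> ennreal (unit_ball_vol (real DIM('a)) * (r * (1/2) ^ k) powr real DIM('a))" .
qed (use r in auto)

lemma powr_le_of_comparable:
  fixes x y c :: real
  assumes "y > 0" "c \<ge> 1" "y / c \<le> x" "x \<le> c * y"
  shows "x powr a \<le> c powr \<bar>a\<bar> * y powr a"
proof (cases "a \<ge> 0")
  case True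
  have "0 < x" using assms by (smt (verit) divide_pos_pos)
  then have "x powr a \<le> (c * y) powr a" using assms True by (intro powr_mono2) auto
  then show ?thesis using assms True by (simp add: powr_mult)
next
  case False
  have "x powr a \<le> (y / c) powr a" using assms False by (intro powr_mono2') auto
  also have "\<dots> = c powr \<bar>a\<bar> * y powr a"
    using assms False by (simp add: powr_divide powr_minus field_simps)
  finally show ?thesis .
qed

text \<open>This is the one integral estimate behind the Schur test.  The symmetric
  quantity \<open>M = |x - z| + \<delta>(x) + \<delta>(z)\<close> makes one kernel serve two regimes.  For \<open>|x - z| < \<delta>(z) / 2\<close> both
  \<open>\<delta>(x)\<close> and \<open>M\<close> are comparable to \<open>\<delta>(z)\<close>, so that only the singularity \<open>|x - z|^(-s)\<close> is felt; otherwise \<open>M\<close> is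
  comparable to \<open>|x - z|\<close>, and integrability at infinity is governed by \<open>\<beta> + s + \<gamma>\<close>.  The power of \<open>\<delta>(z)\<close>
  on the right is dictated by scaling.\<close>

lemma kernel_integral_bound:
  fixes E :: "'a::euclidean_space set"
  assumes adm: "assouad_admissible E l" and E: "closed E" "E \<noteq> {}" and l: "0 \<le> l"
    and \<beta>: "\<beta> < real DIM('a) - l" and s: "s < real DIM('a)" and \<gamma>: "real DIM('a) < \<beta> + s + \<gamma>"
  obtains C where "C > 0" and "\<And>z. z \<notin> E \<Longrightarrow>
    (\<integral>\<^sup>+x\<in>-E. ennreal (infdist x E powr (-\<beta>) * dist x z powr (-s)
        * (dist x z + infdist x E + infdist z E) powr (-\<gamma>)) \<partial>lborel)
      \<le> ennreal (C * infdist z E powr (real DIM('a) - \<beta> - s - \<gamma>))"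
proof -
  define n where "n = real DIM('a)"
  define \<delta> where "\<delta> x = infdist x E" for x
  have [measurable]: "\<delta> \<in> borel_measurable borel" unfolding \<delta>_def by measurable
  have [measurable]: "E \<in> sets borel" using E by simp
  obtain C where C: "C > 0" and Cb: "\<And>z r. 0 < r \<Longrightarrow> \<delta> z \<le> r \<Longrightarrow>
    (\<integral>\<^sup>+x\<in>ball z r - E. ennreal (\<delta> x powr (-\<beta>)) \<partial>lborel) \<le> ennreal (C * r powr (n - \<beta>))"
    unfolding \<delta>_def n_def by (rule ball_infdist_weight_bound[OF adm E l \<beta>]) blast
  define C1 where "C1 = 2 powr \<bar>\<beta>\<bar> * 3 powr \<bar>\<gamma>\<bar>
    * (2 powr \<bar>s\<bar> / (1 - (1/2) powr (n - s)) * unit_ball_vol n) * 2 powr (s - n)"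
  define C2 where "C2 = 6 powr \<bar>\<gamma>\<bar> * (2 powr \<bar>s + \<gamma>\<bar> / (1 - 2 powr (n - \<beta> - (s + \<gamma>))) * (C * 2 powr (n - \<beta>)))"
  have small1: "(1/2) powr (n - s) < (1::real)"
    using s powr_less_mono2[of "n - s" "1/2" 1] by (simp add: n_def)
  have small2: "2 powr (n - \<beta> - (s + \<gamma>)) < (1::real)"
    using \<gamma> powr_less_mono[of "n - \<beta> - (s + \<gamma>)" 0 2] by (simp add: n_def)
  have C1: "C1 > 0" unfolding C1_def n_def using small1
    by (intro mult_pos_pos divide_pos_pos) (auto simp: n_def)
  have C2: "C2 > 0" unfolding C2_def using small2 C by (intro mult_pos_pos divide_pos_pos) auto
  show thesis
  proof (rule that[of "C1 + C2"])
    show "C1 + C2 > 0" using C1 C2 by simp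
    fix z assume z: "z \<notin> E"
    define \<rho> where "\<rho> = \<delta> z"
    have \<rho>: "\<rho> > 0" using z E by (simp add: \<rho>_def \<delta>_def infdist_pos_iff)
    have lip1: "\<delta> x \<le> dist x z + \<rho>" and lip2: "\<rho> \<le> dist x z + \<delta> x" for x
      using infdist_triangle[of x E z] infdist_triangle[of z E x]
      by (auto simp: \<delta>_def \<rho>_def dist_commute add.commute)
    define F where "F x = \<delta> x powr (-\<beta>) * dist x z powr (-s) * (dist x z + \<delta> x + \<rho>) powr (-\<gamma>)" for x
    \<comment> \<open>The far part is integrated by dyadic shells around z, with the volume of a shell weighted by the power of the distance to E.\<close>
    define near where "near = ball z (\<rho>/2) - {z}"
    define far where "far = {x. x \<notin> E \<and> \<rho> \<le> 2 * dist x z}"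
    have [measurable]: "near \<in> sets borel" "far \<in> sets borel" unfolding near_def far_def by measurable
    have \<delta>pos: "\<delta> x > 0" if "x \<notin> E" for x using that E by (simp add: \<delta>_def infdist_pos_iff)
    have split: "ennreal (F x) * indicator (-E) x \<le>
        ennreal (2 powr \<bar>\<beta>\<bar> * 3 powr \<bar>\<gamma>\<bar> * \<rho> powr (-\<beta>-\<gamma>)) * (ennreal (dist x z powr (-s)) * indicator near x)
      + ennreal (6 powr \<bar>\<gamma>\<bar>) * (ennreal (\<delta> x powr (-\<beta>)) * (ennreal (dist x z powr (-(s + \<gamma>))) * indicator far x))" for x
    proof -
      have "x = z \<or> x \<in> E \<or> x \<in> near \<or> x \<in> far \<and> x \<noteq> z \<and> x \<notin> E"
        by (auto simp: near_def far_def dist_commute)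
      then consider "x = z" | "x \<in> E" | "x \<in> near" | "x \<in> far" "x \<noteq> z" "x \<notin> E"
        by blast
      then show ?thesis
      proof cases
        case 1
        then show ?thesis by (simp add: F_def)
      next
        case 2
        then show ?thesis by simp
      next
        case 3
        have d: "dist x z \<le> \<rho> / 2" using 3 by (simp add: near_def dist_commute)
        have "\<delta> x powr (-\<beta>) \<le> 2 powr \<bar>-\<beta>\<bar> * \<rho> powr (-\<beta>)"
          using \<rho> lip1[of x] lip2[of x] d by (intro powr_le_of_comparable) auto
        moreover have "(dist x z + \<delta> x + \<rho>) powr (-\<gamma>) \<le> 3 powr \<bar>-\<gamma>\<bar> * \<rho> powr (-\<gamma>)"
          using \<rho> lip1[of x] lip2[of x] d by (intro powr_le_of_comparable) auto
        ultimately have "F x \<le> (2 powr \<bar>-\<beta>\<bar> * \<rho> powr (-\<beta>)) * dist x z powr (-s) * (3 powr \<bar>-\<gamma>\<bar> * \<rho> powr (-\<gamma>))"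
          unfolding F_def by (intro mult_mono) auto
        also have "\<dots> = 2 powr \<bar>\<beta>\<bar> * 3 powr \<bar>\<gamma>\<bar> * \<rho> powr (-\<beta>-\<gamma>) * dist x z powr (-s)"
          using powr_add[of \<rho> "-\<beta>" "-\<gamma>"] by simp
        finally have "ennreal (F x) \<le> ennreal (2 powr \<bar>\<beta>\<bar> * 3 powr \<bar>\<gamma>\<bar> * \<rho> powr (-\<beta>-\<gamma>)) * ennreal (dist x z powr (-s))"
          by (subst ennreal_mult[symmetric]) (auto intro: ennreal_leI)
        then have "ennreal (F x) * indicator (-E) x \<le> ennreal (2 powr \<bar>\<beta>\<bar> * 3 powr \<bar>\<gamma>\<bar> * \<rho> powr (-\<beta>-\<gamma>)) * (ennreal (dist x z powr (-s)) * indicator near x)"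
          using 3 by (auto split: split_indicator)
        then show ?thesis by (rule order.trans[OF _ add_increasing2]) auto
      next
        case 4
        have t: "dist x z > 0" "\<rho> \<le> 2 * dist x z" using 4 by (auto simp: far_def)
        have "(dist x z + \<delta> x + \<rho>) powr (-\<gamma>) \<le> 6 powr \<bar>-\<gamma>\<bar> * dist x z powr (-\<gamma>)"
          using \<rho> \<delta>pos[OF 4(3)] lip1[of x] lip2[of x] t by (intro powr_le_of_comparable) auto
        then have "F x \<le> \<delta> x powr (-\<beta>) * dist x z powr (-s) * (6 powr \<bar>-\<gamma>\<bar> * dist x z powr (-\<gamma>))"
          unfolding F_def by (intro mult_left_mono) auto
        also have "\<dots> = 6 powr \<bar>\<gamma>\<bar> * (\<delta> x powr (-\<beta>) * dist x z powr (-(s + \<gamma>)))"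
          using powr_add[of "dist x z" "-s" "-\<gamma>"] by simp
        finally have "ennreal (F x) \<le> ennreal (6 powr \<bar>\<gamma>\<bar>) * (ennreal (\<delta> x powr (-\<beta>)) * ennreal (dist x z powr (-(s + \<gamma>))))"
          by (auto intro: ennreal_leI simp flip: ennreal_mult)
        then show ?thesis using 4 by (auto intro: add_increasing split: split_indicator)
      qed
    qed
    have near: "(\<integral>\<^sup>+x. ennreal (dist x z powr (-s)) * indicator near x \<partial>lborel)
       \<le> ennreal (2 powr \<bar>s\<bar> / (1 - (1/2) powr (n - s)) * unit_ball_vol n * (\<rho>/2) powr (n - s))"
      unfolding near_def n_def using \<rho> by (intro ball_dist_weight_bound s) auto
    define \<mu> where "\<mu> = density lborel (\<lambda>x. ennreal (\<delta> x powr (-\<beta>)))"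
    have far: "(\<integral>\<^sup>+x\<in>far. ennreal (dist x z powr (-(s + \<gamma>))) \<partial>\<mu>)
      \<le> ennreal (2 powr \<bar>s + \<gamma>\<bar> / (1 - 2 powr (n - \<beta> - (s + \<gamma>))) * (C * 2 powr (n - \<beta>)) * \<rho> powr (n - \<beta> - (s + \<gamma>)))"
    proof (rule dyadic_nn_integral_bound)
      show "(\<lambda>x. dist x z) \<in> borel_measurable \<mu>" unfolding \<mu>_def by measurable
      show "far \<in> sets \<mu>" unfolding \<mu>_def by simp
      show "dist x z > 0" if "x \<in> far" for x using that \<rho> by (auto simp: far_def)
      show "\<exists>k::nat. \<rho> * 2 ^ k / 2 \<le> dist x z \<and> dist x z \<le> \<rho> * 2 ^ k" if "x \<in> far" for x
        using that \<rho> by (intro ex_dyadic_shell_up) (auto simp: far_def)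
      fix k :: nat
      define r where "r = \<rho> * 2 ^ k"
      have r: "r > 0" "\<rho> \<le> r" using \<rho> by (auto simp: r_def)
      have "emeasure \<mu> {x \<in> far. r / 2 \<le> dist x z \<and> dist x z \<le> r}
        = (\<integral>\<^sup>+x\<in>{x \<in> far. r / 2 \<le> dist x z \<and> dist x z \<le> r}. ennreal (\<delta> x powr (-\<beta>)) \<partial>lborel)"
        unfolding \<mu>_def by (rule emeasure_density) measurable
      also have "\<dots> \<le> (\<integral>\<^sup>+x\<in>ball z (2 * r) - E. ennreal (\<delta> x powr (-\<beta>)) \<partial>lborel)"
        using r by (intro nn_integral_mono mult_left_mono) (auto split: split_indicator simp: far_def dist_commute)
      also have "\<dots> \<le> ennreal (C * (2 * r) powr (n - \<beta>))"
        using r by (intro Cb) (auto simp: \<rho>_def)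
      also have "C * (2 * r) powr (n - \<beta>) = C * 2 powr (n - \<beta>) * r powr (n - \<beta>)"
        using r by (simp add: powr_mult)
      finally show "emeasure \<mu> {x \<in> far. \<rho> * 2 ^ k / 2 \<le> dist x z \<and> dist x z \<le> \<rho> * 2 ^ k}
        \<le> ennreal (C * 2 powr (n - \<beta>) * (\<rho> * 2 ^ k) powr (n - \<beta>))"
        unfolding r_def .
    qed (use \<rho> C small2 in auto)
    have far': "(\<integral>\<^sup>+x\<in>far. ennreal (dist x z powr (-(s + \<gamma>))) \<partial>\<mu>)
       = (\<integral>\<^sup>+x. ennreal (\<delta> x powr (-\<beta>)) * (ennreal (dist x z powr (-(s + \<gamma>))) * indicator far x) \<partial>lborel)"
      unfolding \<mu>_def by (rule nn_integral_density) measurable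
    have "(\<integral>\<^sup>+x\<in>-E. ennreal (F x) \<partial>lborel) \<le>
       (\<integral>\<^sup>+x. ennreal (2 powr \<bar>\<beta>\<bar> * 3 powr \<bar>\<gamma>\<bar> * \<rho> powr (-\<beta>-\<gamma>)) * (ennreal (dist x z powr (-s)) * indicator near x)
      + ennreal (6 powr \<bar>\<gamma>\<bar>) * (ennreal (\<delta> x powr (-\<beta>)) * (ennreal (dist x z powr (-(s + \<gamma>))) * indicator far x)) \<partial>lborel)"
      by (intro nn_integral_mono split)
    also have "\<dots> = ennreal (2 powr \<bar>\<beta>\<bar> * 3 powr \<bar>\<gamma>\<bar> * \<rho> powr (-\<beta>-\<gamma>)) * (\<integral>\<^sup>+x. ennreal (dist x z powr (-s)) * indicator near x \<partial>lborel)
       + ennreal (6 powr \<bar>\<gamma>\<bar>) * (\<integral>\<^sup>+x\<in>far. ennreal (dist x z powr (-(s + \<gamma>))) \<partial>\<mu>)"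
      unfolding far' by (subst nn_integral_add) (simp_all add: nn_integral_cmult)
    also have "\<dots> \<le> ennreal (2 powr \<bar>\<beta>\<bar> * 3 powr \<bar>\<gamma>\<bar> * \<rho> powr (-\<beta>-\<gamma>)) *
          ennreal (2 powr \<bar>s\<bar> / (1 - (1/2) powr (n - s)) * unit_ball_vol n * (\<rho>/2) powr (n - s))
       + ennreal (6 powr \<bar>\<gamma>\<bar>) *
          ennreal (2 powr \<bar>s + \<gamma>\<bar> / (1 - 2 powr (n - \<beta> - (s + \<gamma>))) * (C * 2 powr (n - \<beta>)) * \<rho> powr (n - \<beta> - (s + \<gamma>)))"
      by (intro add_mono mult_left_mono near far) auto
    also have "\<dots> = ennreal (2 powr \<bar>\<beta>\<bar> * 3 powr \<bar>\<gamma>\<bar> * \<rho> powr (-\<beta>-\<gamma>) *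
          (2 powr \<bar>s\<bar> / (1 - (1/2) powr (n - s)) * unit_ball_vol n * (\<rho>/2) powr (n - s))
       + 6 powr \<bar>\<gamma>\<bar> *
          (2 powr \<bar>s + \<gamma>\<bar> / (1 - 2 powr (n - \<beta> - (s + \<gamma>))) * (C * 2 powr (n - \<beta>)) * \<rho> powr (n - \<beta> - (s + \<gamma>))))"
      using small1 small2 C
      by (subst ennreal_plus) (auto simp: ennreal_mult n_def simp del: times_divide_eq_left times_divide_eq_right intro!: mult_nonneg_nonneg divide_nonneg_nonneg)
    also have "2 powr \<bar>\<beta>\<bar> * 3 powr \<bar>\<gamma>\<bar> * \<rho> powr (-\<beta>-\<gamma>) *
          (2 powr \<bar>s\<bar> / (1 - (1/2) powr (n - s)) * unit_ball_vol n * (\<rho>/2) powr (n - s))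
        = C1 * (\<rho> powr (-\<beta>-\<gamma>) * \<rho> powr (n - s))"
    proof -
      have "(\<rho>/2) powr (n - s) = \<rho> powr (n - s) * 2 powr (s - n)"
        using \<rho> powr_minus_divide[of 2 "n - s"] by (simp add: powr_divide)
      then show ?thesis unfolding C1_def by (simp add: mult_ac)
    qed
    also have "\<rho> powr (-\<beta>-\<gamma>) * \<rho> powr (n - s) = \<rho> powr (n - \<beta> - s - \<gamma>)"
      by (simp add: algebra_simps flip: powr_add)
    also have "C1 * \<rho> powr (n - \<beta> - s - \<gamma>) + 6 powr \<bar>\<gamma>\<bar> *
          (2 powr \<bar>s + \<gamma>\<bar> / (1 - 2 powr (n - \<beta> - (s + \<gamma>))) * (C * 2 powr (n - \<beta>)) * \<rho> powr (n - \<beta> - (s + \<gamma>)))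
        = (C1 + C2) * \<rho> powr (n - \<beta> - s - \<gamma>)"
      unfolding C2_def by (simp add: ring_distribs diff_diff_eq mult_ac add_ac)
    finally show "(\<integral>\<^sup>+x\<in>-E. ennreal (infdist x E powr (-\<beta>) * dist x z powr (-s)
        * (dist x z + infdist x E + infdist z E) powr (-\<gamma>)) \<partial>lborel)
      \<le> ennreal ((C1 + C2) * infdist z E powr (real DIM('a) - \<beta> - s - \<gamma>))"
      by (simp add: F_def \<rho>_def n_def \<delta>_def[abs_def] )
  qed
qed

section \<open>Hoelder's inequality and a Schur test\<close>

text \<open>Young's inequality for \<open>f / X^(1/p)\<close> and \<open>g / Y^(1/q)\<close>, integrated.  Upper bounds \<open>X\<close>, \<open>Y\<close> in place of the
  integrals keep all powers finite.\<close>

lemma nn_integral_Hoelder: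
  fixes f g :: "'a \<Rightarrow> real"
  assumes [measurable]: "f \<in> borel_measurable M" "g \<in> borel_measurable M"
    and nn: "\<And>x. f x \<ge> 0" "\<And>x. g x \<ge> 0"
    and p: "p > 1" "q > 1" "1/p + 1/q = 1"
    and X: "X \<ge> 0" "(\<integral>\<^sup>+x. ennreal (f x powr p) \<partial>M) \<le> ennreal X"
    and Y: "Y \<ge> 0" "(\<integral>\<^sup>+x. ennreal (g x powr q) \<partial>M) \<le> ennreal Y"
  shows "(\<integral>\<^sup>+x. ennreal (f x * g x) \<partial>M) \<le> ennreal (X powr (1/p) * Y powr (1/q))"
proof (cases "X = 0 \<or> Y = 0")
  case True
  have "AE x in M. f x * g x = 0"
    using True
  proof
    assume "X = 0"
    with X have "(\<integral>\<^sup>+x. ennreal (f x powr p) \<partial>M) = 0" by simp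
    then have "AE x in M. ennreal (f x powr p) = 0"
      by (subst (asm) nn_integral_0_iff_AE) auto
    then show ?thesis by eventually_elim auto
  next
    assume "Y = 0"
    with Y have "(\<integral>\<^sup>+x. ennreal (g x powr q) \<partial>M) = 0" by simp
    then have "AE x in M. ennreal (g x powr q) = 0"
      by (subst (asm) nn_integral_0_iff_AE) auto
    then show ?thesis by eventually_elim auto
  qed
  then have "(\<integral>\<^sup>+x. ennreal (f x * g x) \<partial>M) = 0"
    by (subst nn_integral_0_iff_AE) auto
  then show ?thesis by simp
next
  case False
  with X Y have pos: "X > 0" "Y > 0" by auto
  define c where "c = X powr (1/p) * Y powr (1/q)"
  have c: "c > 0" using pos by (simp add: c_def)
  have le: "f x * g x \<le> c * (1 / (p * X)) * f x powr p + c * (1 / (q * Y)) * g x powr q" for x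
  proof -
    have "(f x / X powr (1/p)) * (g x / Y powr (1/q))
        \<le> (f x / X powr (1/p)) powr p / p + (g x / Y powr (1/q)) powr q / q"
      using p nn pos by (intro Youngs_inequality) auto
    also have "\<dots> = 1 / (p * X) * f x powr p + 1 / (q * Y) * g x powr q"
      using p nn pos by (simp add: powr_divide powr_powr mult.commute)
    finally have "c * ((f x / X powr (1/p)) * (g x / Y powr (1/q)))
        \<le> c * (1 / (p * X) * f x powr p + 1 / (q * Y) * g x powr q)"
      using c by (intro mult_left_mono) auto
    moreover have "c * ((f x / X powr (1/p)) * (g x / Y powr (1/q))) = f x * g x"
      using pos by (simp add: c_def)
    ultimately show ?thesis by (simp add: ring_distribs mult_ac)
  qed
  have "(\<integral>\<^sup>+x. ennreal (f x * g x) \<partial>M) \<le>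
      (\<integral>\<^sup>+x. ennreal (c * (1 / (p * X))) * ennreal (f x powr p) + ennreal (c * (1 / (q * Y))) * ennreal (g x powr q) \<partial>M)"
    using le c p pos by (intro nn_integral_mono) (auto simp flip: ennreal_mult ennreal_plus)
  also have "\<dots> = ennreal (c * (1 / (p * X))) * (\<integral>\<^sup>+x. ennreal (f x powr p) \<partial>M)
      + ennreal (c * (1 / (q * Y))) * (\<integral>\<^sup>+x. ennreal (g x powr q) \<partial>M)"
    by (subst nn_integral_add) (auto simp: nn_integral_cmult)
  also have "\<dots> \<le> ennreal (c * (1 / (p * X))) * ennreal X + ennreal (c * (1 / (q * Y))) * ennreal Y"
    by (intro add_mono mult_left_mono X Y) auto
  also have "\<dots> = ennreal (c * (1 / (p * X)) * X + c * (1 / (q * Y)) * Y)"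
    using c p pos by (simp flip: ennreal_mult ennreal_plus)
  also have "c * (1 / (p * X)) * X + c * (1 / (q * Y)) * Y = c * (1/p + 1/q)"
    using pos p(1,2) by (simp add: ring_distribs)
  finally show ?thesis unfolding p(3) c_def by simp
qed

text \<open>The exponents are \<open>p / (p - 1)\<close>, \<open>q\<close> and \<open>p q / (q - p)\<close>, applied to the factors
  \<open>A\<close>, \<open>B g^(p / q)\<close> and \<open>g^(1 - p / q)\<close>.\<close>

lemma nn_integral_Hoelder3:
  fixes A B g :: "'a \<Rightarrow> real"
  assumes [measurable]: "A \<in> borel_measurable M" "B \<in> borel_measurable M" "g \<in> borel_measurable M"
    and nn: "\<And>x. A x \<ge> 0" "\<And>x. B x \<ge> 0" "\<And>x. g x \<ge> 0"
    and p: "1 < p" "p < q"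
    and a: "a \<ge> 0" "(\<integral>\<^sup>+x. ennreal (A x powr (p / (p - 1))) \<partial>M) \<le> ennreal (a powr (p / (p - 1)))"
    and X: "X \<ge> 0" "(\<integral>\<^sup>+x. ennreal (g x powr p) \<partial>M) \<le> ennreal X"
    and Y: "Y \<ge> 0" "(\<integral>\<^sup>+x. ennreal (B x powr q * g x powr p) \<partial>M) \<le> ennreal Y"
  shows "(\<integral>\<^sup>+x. ennreal (A x * B x * g x) \<partial>M) \<le> ennreal (a * X powr (1/p - 1/q) * Y powr (1/q))"
proof -
  define Z where "Z = Y powr (1 / (q/p)) * X powr (1 / (q/(q-p)))"
  have "(\<integral>\<^sup>+x. ennreal ((B x powr p * g x powr (p * p / q)) * g x powr (p * (1 - p / q))) \<partial>M) \<le> ennreal Z"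
    unfolding Z_def
  proof (rule nn_integral_Hoelder)
    have "(B x powr p * g x powr (p * p / q)) powr (q / p) = B x powr q * g x powr p" for x
      using nn p by (simp add: powr_mult powr_powr)
    then show "(\<integral>\<^sup>+x. ennreal ((B x powr p * g x powr (p * p / q)) powr (q / p)) \<partial>M) \<le> ennreal Y"
      using Y by simp
    have "p * (1 - p / q) * (q / (q - p)) = p" using p by (simp add: field_simps)
    then have "(g x powr (p * (1 - p / q))) powr (q / (q - p)) = g x powr p" for x
      by (simp only: powr_powr)
    then show "(\<integral>\<^sup>+x. ennreal ((g x powr (p * (1 - p / q))) powr (q / (q - p))) \<partial>M) \<le> ennreal X"
      using X by simp
    show "q / (q - p) > 1" using p by (simp add: field_simps)
  qed (use p X Y nn in \<open>auto simp: field_simps\<close>)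
  also have "(\<lambda>x. ennreal ((B x powr p * g x powr (p * p / q)) * g x powr (p * (1 - p / q))))
      = (\<lambda>x. ennreal ((B x * g x) powr p))"
  proof
    fix x
    have "p * p / q + p * (1 - p / q) = p" using p by (simp add: field_simps)
    then have "g x powr (p * p / q) * g x powr (p * (1 - p / q)) = g x powr p"
      by (simp only: flip: powr_add)
    then show "ennreal ((B x powr p * g x powr (p * p / q)) * g x powr (p * (1 - p / q))) = ennreal ((B x * g x) powr p)"
      using nn by (simp add: powr_mult mult.assoc)
  qed
  finally have Z: "(\<integral>\<^sup>+x. ennreal ((B x * g x) powr p) \<partial>M) \<le> ennreal Z" .
  have "(\<integral>\<^sup>+x. ennreal (A x * (B x * g x)) \<partial>M)
     \<le> ennreal ((a powr (p / (p - 1))) powr (1 / (p / (p - 1))) * Z powr (1/p))"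
  proof (rule nn_integral_Hoelder)
    show "p / (p - 1) > 1" using p by (simp add: field_simps)
    show "1 / (p / (p - 1)) + 1 / p = 1" using p by (simp add: field_simps)
  qed (use p a Z nn in \<open>auto simp: Z_def\<close>)
  also have "(a powr (p / (p - 1))) powr (1 / (p / (p - 1))) = a"
    using a p by (simp add: powr_powr)
  also have "Z powr (1/p) = X powr (1/p - 1/q) * Y powr (1/q)"
  proof -
    have "1 / (q / (q - p)) * (1 / p) = 1/p - 1/q" "1 / (q / p) * (1 / p) = 1 / q" using p by (simp_all add: field_simps)
    then show ?thesis unfolding Z_def using X Y
      by (subst powr_mult) (auto simp only: powr_powr mult.commute powr_ge_zero)
  qed
  finally show ?thesis by (simp add: mult.assoc)
qed

text \<open>If the kernel \<open>A B\<close> is split so that \<open>A(x, \<cdot>)\<close> has norm at most \<open>a(x)\<close> in \<open>L^(p / (p - 1))\<close>, then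
  Hoelder's inequality bounds \<open>U(x)^q\<close> by \<open>a(x)^q\<close> times the integral of \<open>B(x, \<cdot>)^q g^p\<close>, and Tonelli's theorem
  moves the integration over \<open>x\<close> inside.  What remains is a bound on \<open>\<integral> (a(x) B(x, y))^q dx\<close> that is uniform in \<open>y\<close>.\<close>

lemma Schur_test:
  fixes A B :: "'a::euclidean_space \<Rightarrow> 'a \<Rightarrow> real" and g U a :: "'a \<Rightarrow> real"
  assumes Am [measurable]: "(\<lambda>(x,y). A x y) \<in> borel_measurable (borel \<Otimes>\<^sub>M borel)"
    and Bm [measurable]: "(\<lambda>(x,y). B x y) \<in> borel_measurable (borel \<Otimes>\<^sub>M borel)"
    and [measurable]: "g \<in> borel_measurable borel" "a \<in> borel_measurable borel" "S \<in> sets borel"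
    and nn: "\<And>x y. A x y \<ge> 0" "\<And>x y. B x y \<ge> 0" "\<And>y. g y \<ge> 0" "\<And>x. U x \<ge> 0"
    and p: "1 < p" "p < q" and D: "D \<ge> 0" and X: "X > 0"
    and a: "\<And>x. x \<in> S \<Longrightarrow> a x > 0"
    and A: "\<And>x. x \<in> S \<Longrightarrow> (\<integral>\<^sup>+y. ennreal (A x y powr (p / (p - 1))) \<partial>lborel) \<le> ennreal (a x powr (p / (p - 1)))"
    and B: "\<And>y. g y \<noteq> 0 \<Longrightarrow> (\<integral>\<^sup>+x\<in>S. ennreal ((a x * B x y) powr q) \<partial>lborel) \<le> ennreal D"
    and g: "(\<integral>\<^sup>+y. ennreal (g y powr p) \<partial>lborel) \<le> ennreal X"
    and U: "\<And>x. x \<in> S \<Longrightarrow> ennreal (U x) \<le> (\<integral>\<^sup>+y. ennreal (A x y * B x y * g y) \<partial>lborel)"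
  shows "(\<integral>\<^sup>+x\<in>S. ennreal (U x powr q) \<partial>lborel) \<le> ennreal (D * X powr (q / p))"
proof -
  define Y where "Y x = (\<integral>\<^sup>+y. ennreal (B x y powr q * g y powr p) \<partial>lborel)" for x
  have pt: "ennreal (U x powr q) \<le> ennreal (X powr (q/p - 1)) * (ennreal (a x powr q) * Y x)" if x: "x \<in> S" for x
  proof (cases "Y x = \<infinity>")
    case True
    then show ?thesis using a[OF x] X p by (simp add: ennreal_mult_top ennreal_mult_eq_top_iff)
  next
    case False
    define y where "y = enn2real (Y x)"
    have y: "y \<ge> 0" "Y x = ennreal y" using False by (auto simp: y_def less_top)
    have "ennreal (U x) \<le> ennreal (a x * X powr (1/p - 1/q) * y powr (1/q))"
    proof (rule order.trans[OF U[OF x] nn_integral_Hoelder3])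
      show "(\<integral>\<^sup>+y. ennreal (B x y powr q * g y powr p) \<partial>lborel) \<le> ennreal y"
        using y by (simp add: Y_def)
      show "(\<lambda>y. A x y) \<in> borel_measurable lborel" "(\<lambda>y. B x y) \<in> borel_measurable lborel"
        using measurable_compose[OF measurable_Pair1' Am, of x] measurable_compose[OF measurable_Pair1' Bm, of x] by simp_all
    qed (use nn p a[OF x] A[OF x] X g y in auto)
    then have "U x \<le> a x * X powr (1/p - 1/q) * y powr (1/q)"
      using a[OF x] by (subst (asm) ennreal_le_iff) auto
    then have "U x powr q \<le> (a x * X powr (1/p - 1/q) * y powr (1/q)) powr q"
      using nn p by (intro powr_mono2) auto
    also have "\<dots> = X powr (q/p - 1) * (a x powr q * y)"
    proof -
      have "(1/p - 1/q) * q = q/p - 1" using p by (simp add: field_simps)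
      then show ?thesis using a[OF x] y(1) p by (simp add: powr_mult powr_powr mult_ac)
    qed
    finally have "ennreal (U x powr q) \<le> ennreal (X powr (q/p - 1) * (a x powr q * y))"
      by (rule ennreal_leI)
    also have "\<dots> = ennreal (X powr (q/p - 1)) * (ennreal (a x powr q) * Y x)"
      using y by (simp add: ennreal_mult)
    finally show ?thesis .
  qed
  have "(\<integral>\<^sup>+x\<in>S. ennreal (U x powr q) \<partial>lborel)
     \<le> (\<integral>\<^sup>+x. ennreal (X powr (q/p - 1)) * (\<integral>\<^sup>+y. indicator S x * ennreal (a x powr q) * ennreal (B x y powr q * g y powr p) \<partial>lborel) \<partial>lborel)"
  proof (intro nn_integral_mono)
    fix x
    have [measurable]: "(\<lambda>y. B x y) \<in> borel_measurable borel"
      using measurable_compose[OF measurable_Pair1' Bm, of x] by simp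
    show "ennreal (U x powr q) * indicator S x \<le> ennreal (X powr (q/p - 1)) *
      (\<integral>\<^sup>+y. indicator S x * ennreal (a x powr q) * ennreal (B x y powr q * g y powr p) \<partial>lborel)"
      using pt[of x] by (subst nn_integral_cmult) (auto simp: Y_def split: split_indicator)
  qed
  also have "\<dots> = ennreal (X powr (q/p - 1)) *
     (\<integral>\<^sup>+x. \<integral>\<^sup>+y. indicator S x * ennreal (a x powr q) * ennreal (B x y powr q * g y powr p) \<partial>lborel \<partial>lborel)"
    by (intro nn_integral_cmult) measurable
  also have "(\<integral>\<^sup>+x. \<integral>\<^sup>+y. indicator S x * ennreal (a x powr q) * ennreal (B x y powr q * g y powr p) \<partial>lborel \<partial>lborel)
    = (\<integral>\<^sup>+y. \<integral>\<^sup>+x. indicator S x * ennreal (a x powr q) * ennreal (B x y powr q * g y powr p) \<partial>lborel \<partial>lborel)"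
    by (intro lborel_pair.Fubini') measurable
  also have "\<dots> \<le> (\<integral>\<^sup>+y. ennreal D * ennreal (g y powr p) \<partial>lborel)"
  proof (intro nn_integral_mono)
    fix y
    have [measurable]: "(\<lambda>x. B x y) \<in> borel_measurable borel"
      using measurable_compose[OF measurable_Pair2' Bm, of y] by simp
    have "(\<integral>\<^sup>+x. indicator S x * ennreal (a x powr q) * ennreal (B x y powr q * g y powr p) \<partial>lborel)
       = (\<integral>\<^sup>+x. ennreal (g y powr p) * (ennreal ((a x * B x y) powr q) * indicator S x) \<partial>lborel)"
    proof (intro nn_integral_cong)
      fix x
      show "indicator S x * ennreal (a x powr q) * ennreal (B x y powr q * g y powr p)
        = ennreal (g y powr p) * (ennreal ((a x * B x y) powr q) * indicator S x)"
        using a[of x] nn(2)[of x y] by (cases "x \<in> S") (auto simp: powr_mult ennreal_mult mult_ac)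
    qed
    also have "\<dots> = ennreal (g y powr p) * (\<integral>\<^sup>+x\<in>S. ennreal ((a x * B x y) powr q) \<partial>lborel)"
      by (intro nn_integral_cmult) measurable
    also have "\<dots> \<le> ennreal D * ennreal (g y powr p)"
      using B[of y] by (cases "g y = 0") (auto simp: mult.commute[of "ennreal D"] intro!: mult_left_mono)
    finally show "(\<integral>\<^sup>+x. indicator S x * ennreal (a x powr q) * ennreal (B x y powr q * g y powr p) \<partial>lborel)
      \<le> ennreal D * ennreal (g y powr p)" .
  qed
  also have "\<dots> = ennreal D * (\<integral>\<^sup>+y. ennreal (g y powr p) \<partial>lborel)"
    by (intro nn_integral_cmult) measurable
  also have "ennreal (X powr (q/p - 1)) * (ennreal D * (\<integral>\<^sup>+y. ennreal (g y powr p) \<partial>lborel))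
     \<le> ennreal (X powr (q/p - 1)) * (ennreal D * ennreal X)"
    by (intro mult_left_mono g) auto
  also have "\<dots> = ennreal (D * (X powr (q/p - 1) * X powr 1))"
    using D X by (simp add: ennreal_mult mult_ac)
  also have "X powr (q/p - 1) * X powr 1 = X powr (q / p)"
    by (simp only: flip: powr_add) simp
  finally show ?thesis by (simp add: mult_left_mono)
qed

section \<open>A weighted bound for the Riesz potential of order two\<close>

text \<open>With \<open>p' = p / (p - 1)\<close> the kernel \<open>\<delta>(x)^(-a) |x - y|^(2 - n) \<delta>(y)^(a - 1)\<close> is split into
  \<open>A = \<delta>(y)^(a - 1 - e) |x - y|^(-s) M^(-m)\<close> and \<open>B = \<delta>(x)^(-a) \<delta>(y)^e |x - y|^(2 - n + s) M^m\<close>.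
  The singularities are integrable when \<open>s p' < n\<close> and \<open>(n - 2 - s) q < n\<close>, that is for \<open>s\<close> between \<open>n / p' - 1\<close>
  and \<open>n / p'\<close>; the midpoint is taken.  The shift \<open>e > 0\<close> gives convergence at infinity, where the
  integrals would otherwise diverge logarithmically, and \<open>m = a - 1/2\<close> is the choice that makes the norm of
  \<open>A(x, \<cdot>)\<close> a multiple of \<open>\<delta>(x)^(-e)\<close>; then the powers of \<open>\<delta>(y)\<close> cancel in the integral of \<open>B\<close>.\<close>

lemma weighted_potential_bound:
  fixes E :: "'a::euclidean_space set" and a p l :: real
  defines "n \<equiv> real DIM('a)"
  defines "q \<equiv> n * p / (n - p)"
  assumes adm: "assouad_admissible E l" and E: "closed E" "E \<noteq> {}" and l: "0 \<le> l"
    and p: "1 < p" "p < n"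
    and a1: "a * q < n - l" and a2: "(1 - a) * (p / (p - 1)) < n - l"
  obtains C where "C > 0" and "\<And>f U X. f \<in> borel_measurable borel \<Longrightarrow> (\<And>y. f y \<ge> 0) \<Longrightarrow> (\<And>x. U x \<ge> 0)
    \<Longrightarrow> X > 0 \<Longrightarrow> (\<integral>\<^sup>+y. ennreal (f y powr p / infdist y E powr ((a - 1) * p)) \<partial>lborel) \<le> ennreal X
    \<Longrightarrow> (\<And>x. ennreal (U x) \<le> (\<integral>\<^sup>+y. ennreal (dist x y powr (2 - n) * f y) \<partial>lborel))
    \<Longrightarrow> (\<integral>\<^sup>+x\<in>-E. ennreal ((U x * infdist x E powr (-a)) powr q) \<partial>lborel) \<le> ennreal (C * X powr (q / p))"
proof -
  define p' where "p' = p / (p - 1)"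
  define \<delta> where "\<delta> x = infdist x E" for x
  have [measurable]: "\<delta> \<in> borel_measurable borel" unfolding \<delta>_def by measurable
  have p': "p' > 1" "1 / p' = 1 - 1 / p" using p by (auto simp: p'_def field_simps)
  have q: "p < q" "1 / q = 1 / p - 1 / n" using p by (auto simp: q_def field_simps)
  have pos: "p > 0" "p' > 0" "q > 0" "n > 0" using p p' q by auto
  have a2': "(1 - a) * p' < n - l" using a2 by (simp add: p'_def)
  \<comment> \<open>Both hypotheses on the exponent are strict, so there is room for a small positive shift.\<close>
  obtain e where e: "e > 0" "(a + e) * q < n - l" "(1 - a + e) * p' < n - l"
  proof -
    define e where "e = min ((n - l - a * q) / (2 * q)) ((n - l - (1 - a) * p') / (2 * p'))"
    have "e > 0" using a1 a2' pos by (auto simp: e_def)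
    moreover have "e * q \<le> (n - l - a * q) / 2" "e * p' \<le> (n - l - (1 - a) * p') / 2"
      using mult_right_mono[of e "(n - l - a * q) / (2 * q)" q] mult_right_mono[of e "(n - l - (1 - a) * p') / (2 * p')" p'] pos
      by (auto simp: e_def)
    ultimately show thesis using a1 a2' by (intro that[of e]) (auto simp: algebra_simps)
  qed
  define s where "s = n / p' - 1 / 2"
  define m where "m = a - 1 / 2"
  define A where "A x y = \<delta> y powr (a - 1 - e) * dist x y powr (-s) * (dist x y + \<delta> x + \<delta> y) powr (-m)" for x y
  define B where "B x y = \<delta> x powr (-a) * \<delta> y powr e * dist x y powr (-(n - 2 - s)) * (dist x y + \<delta> x + \<delta> y) powr m" for x y
  have n_p': "n / p' = n - n / p" using arg_cong[OF p'(2), of "\<lambda>t. n * t"] pos by (simp add: right_diff_distrib)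
  have n_q: "n / q = n / p - 1" using arg_cong[OF q(2), of "\<lambda>t. n * t"] pos by (simp add: right_diff_distrib)
  have s1: "s * p' = n - p' / 2" using pos by (simp add: s_def left_diff_distrib)
  have s2: "(n - 2 - s) * q = n - q / 2"
  proof -
    have "n - 2 - s = n / q - 1 / 2" unfolding s_def n_p' n_q by simp
    then show ?thesis using pos by (simp add: left_diff_distrib)
  qed
  \<comment> \<open>The exponents that scaling produces on the right-hand sides of the two kernel integrals.\<close>
  have e1: "n - (1 - a + e) * p' - s * p' - m * p' = - (e * p')"
    unfolding s1 m_def by (simp add: algebra_simps)
  have e2: "n - (a + e) * q - (n - 2 - s) * q - (- m) * q = - (e * q)"
    unfolding s2 m_def by (simp add: algebra_simps)
  obtain C1 where C1: "C1 > 0" and C1b: "\<And>z. z \<notin> E \<Longrightarrow>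
    (\<integral>\<^sup>+x\<in>-E. ennreal (\<delta> x powr (-((1 - a + e) * p')) * dist x z powr (-(s * p'))
        * (dist x z + \<delta> x + \<delta> z) powr (-(m * p'))) \<partial>lborel)
      \<le> ennreal (C1 * \<delta> z powr (n - (1 - a + e) * p' - s * p' - m * p'))"
    unfolding \<delta>_def n_def
  proof (rule kernel_integral_bound[OF adm E l])
    show "(1 - a + e) * p' < real DIM('a) - l" using e by (simp add: n_def)
    show "s * p' < real DIM('a)" using s1 pos by (simp add: n_def)
    have "e * p' > 0" using e pos by simp
    then show "real DIM('a) < (1 - a + e) * p' + s * p' + m * p'" using e1 by (simp add: n_def)
  qed blast
  obtain C2 where C2: "C2 > 0" and C2b: "\<And>z. z \<notin> E \<Longrightarrow>
    (\<integral>\<^sup>+x\<in>-E. ennreal (\<delta> x powr (-((a + e) * q)) * dist x z powr (-((n - 2 - s) * q))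
        * (dist x z + \<delta> x + \<delta> z) powr (-(-m * q))) \<partial>lborel)
      \<le> ennreal (C2 * \<delta> z powr (n - (a + e) * q - (n - 2 - s) * q - (-m) * q))"
    unfolding \<delta>_def n_def
  proof (rule kernel_integral_bound[OF adm E l])
    show "(a + e) * q < real DIM('a) - l" using e by (simp add: n_def)
    show "(real DIM('a) - 2 - s) * q < real DIM('a)" using s2 pos by (simp add: n_def)
    have "e * q > 0" using e pos by simp
    then show "real DIM('a) < (a + e) * q + (real DIM('a) - 2 - s) * q + (- m) * q" using e2 by (simp add: n_def)
  qed blast
  define D where "D = C1 powr (q / p') * C2"
  have D: "D > 0" using C1 C2 by (simp add: D_def)
  have \<delta>pos: "\<delta> x > 0" if "x \<notin> E" for x using that E by (simp add: \<delta>_def infdist_pos_iff)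
  have \<delta>0: "\<delta> x = 0" if "x \<in> E" for x using that by (simp add: \<delta>_def)
  have \<delta>nn: "\<delta> x \<ge> 0" for x by (simp add: \<delta>_def infdist_nonneg)
  have ln: "l < n"
  proof (rule ccontr)
    assume "\<not> l < n"
    then have "(a + e) * q < 0" "(1 - a + e) * p' < 0" using e by auto
    then have "a + e < 0" "1 - a + e < 0" using pos by (auto simp: mult_less_0_iff)
    with e show False by linarith
  qed
  have null: "E \<in> null_sets lborel"
    using assouad_admissible_null_set[OF adm E l] ln by (simp add: n_def)
  show thesis
  proof (rule that[OF D])
    fix f U :: "'a \<Rightarrow> real" and X :: real
    assume [measurable]: "f \<in> borel_measurable borel" and f: "\<And>y. f y \<ge> 0" and U0: "\<And>x. U x \<ge> 0" and X: "X > 0"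
      and fX: "(\<integral>\<^sup>+y. ennreal (f y powr p / infdist y E powr ((a - 1) * p)) \<partial>lborel) \<le> ennreal X"
      and U: "\<And>x. ennreal (U x) \<le> (\<integral>\<^sup>+y. ennreal (dist x y powr (2 - n) * f y) \<partial>lborel)"
    define g where "g y = f y * \<delta> y powr (1 - a)" for y
    have "(\<integral>\<^sup>+x\<in>-E. ennreal ((U x * \<delta> x powr (-a)) powr q) \<partial>lborel) \<le> ennreal (D * X powr (q / p))"
    proof (rule Schur_test[where A = A and B = B and g = g and a = "\<lambda>x. C1 powr (1 / p') * \<delta> x powr (-e)"])
      show "(\<lambda>(x, y). A x y) \<in> borel_measurable (borel \<Otimes>\<^sub>M borel)" unfolding A_def by measurable
      show "(\<lambda>(x, y). B x y) \<in> borel_measurable (borel \<Otimes>\<^sub>M borel)" unfolding B_def by measurable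
      show "g \<in> borel_measurable borel" unfolding g_def by measurable
      show "-E \<in> sets borel" using E by simp
      show "C1 powr (1 / p') * \<delta> x powr (-e) > 0" if "x \<in> -E" for x
        using \<delta>pos[of x] that C1 by (intro mult_pos_pos) auto
      show "(\<integral>\<^sup>+y. ennreal (g y powr p) \<partial>lborel) \<le> ennreal X"
      proof -
        have "g y powr p = f y powr p / infdist y E powr ((a - 1) * p)" for y
        proof -
          have "(1 - a) * p = -((a - 1) * p)" by (simp add: algebra_simps)
          then have "g y powr p = f y powr p * \<delta> y powr (-((a - 1) * p))"
            unfolding g_def powr_mult powr_powr by simp
          then show ?thesis by (simp only: powr_minus_divide \<delta>_def) simp
        qed
        then show ?thesis using fX by simp
      qed
      show "(\<integral>\<^sup>+y. ennreal (A x y powr (p / (p - 1))) \<partial>lborel)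
          \<le> ennreal ((C1 powr (1 / p') * \<delta> x powr (-e)) powr (p / (p - 1)))" if x: "x \<in> -E" for x
      proof -
        have "(\<integral>\<^sup>+y. ennreal (A x y powr p') \<partial>lborel) =
          (\<integral>\<^sup>+y\<in>-E. ennreal (\<delta> y powr (-((1 - a + e) * p')) * dist y x powr (-(s * p'))
            * (dist y x + \<delta> y + \<delta> x) powr (-(m * p'))) \<partial>lborel)"
        proof (intro nn_integral_cong)
          fix y
          have "(a - 1 - e) * p' = -((1 - a + e) * p')" by (simp add: algebra_simps)
          then show "ennreal (A x y powr p') = ennreal (\<delta> y powr (-((1 - a + e) * p')) * dist y x powr (-(s * p'))
            * (dist y x + \<delta> y + \<delta> x) powr (-(m * p'))) * indicator (-E) y"
            using \<delta>0[of y] by (cases "y \<in> E") (auto simp: A_def powr_mult powr_powr dist_commute add_ac)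
        qed
        also have "\<dots> \<le> ennreal (C1 * \<delta> x powr (n - (1 - a + e) * p' - s * p' - m * p'))"
          using x by (intro C1b) auto
        also have "\<dots> = ennreal ((C1 powr (1 / p') * \<delta> x powr (-e)) powr p')"
          unfolding e1 using C1 pos by (simp add: powr_mult powr_powr)
        finally show ?thesis by (simp add: p'_def)
      qed
      show "(\<integral>\<^sup>+x\<in>-E. ennreal ((C1 powr (1 / p') * \<delta> x powr (-e) * B x y) powr q) \<partial>lborel) \<le> ennreal D"
        if y: "g y \<noteq> 0" for y
      proof -
        have yE: "y \<notin> E" using y \<delta>0[of y] by (auto simp: g_def)
        have "(\<integral>\<^sup>+x\<in>-E. ennreal ((C1 powr (1 / p') * \<delta> x powr (-e) * B x y) powr q) \<partial>lborel)
          = (\<integral>\<^sup>+x. ennreal (C1 powr (q / p') * \<delta> y powr (e * q)) *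
              (ennreal (\<delta> x powr (-((a + e) * q)) * dist x y powr (-((n - 2 - s) * q))
              * (dist x y + \<delta> x + \<delta> y) powr (-(-m * q))) * indicator (-E) x) \<partial>lborel)"
        proof (intro nn_integral_cong)
          fix x
          have ae: "\<delta> x powr (-e) * \<delta> x powr (-a) = \<delta> x powr (-(a + e))"
            by (simp add: algebra_simps flip: powr_add)
          have "C1 powr (1 / p') * \<delta> x powr (-e) * B x y
            = C1 powr (1 / p') * \<delta> y powr e * (\<delta> x powr (-(a + e)) * dist x y powr (-(n - 2 - s)) * (dist x y + \<delta> x + \<delta> y) powr m)"
            unfolding B_def ae[symmetric] by (simp only: mult_ac)
          moreover have "(C1 powr (1 / p') * \<delta> y powr e * (\<delta> x powr (-(a + e)) * dist x y powr (-(n - 2 - s)) * (dist x y + \<delta> x + \<delta> y) powr m)) powr q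
            = C1 powr (q / p') * \<delta> y powr (e * q) *
              (\<delta> x powr (-((a + e) * q)) * dist x y powr (-((n - 2 - s) * q)) * (dist x y + \<delta> x + \<delta> y) powr (-(-m * q)))"
            by (simp only: powr_mult powr_powr mult_minus_left minus_minus times_divide_eq_left mult_1)
          ultimately have eq: "(C1 powr (1 / p') * \<delta> x powr (-e) * B x y) powr q
            = C1 powr (q / p') * \<delta> y powr (e * q) *
              (\<delta> x powr (-((a + e) * q)) * dist x y powr (-((n - 2 - s) * q)) * (dist x y + \<delta> x + \<delta> y) powr (-(-m * q)))"
            by (simp only:)
          show "ennreal ((C1 powr (1 / p') * \<delta> x powr (-e) * B x y) powr q) * indicator (-E) x
            = ennreal (C1 powr (q / p') * \<delta> y powr (e * q)) *
              (ennreal (\<delta> x powr (-((a + e) * q)) * dist x y powr (-((n - 2 - s) * q))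
              * (dist x y + \<delta> x + \<delta> y) powr (-(-m * q))) * indicator (-E) x)"
            unfolding eq by (subst ennreal_mult) (simp_all add: mult.assoc)
        qed
        also have "\<dots> = ennreal (C1 powr (q / p') * \<delta> y powr (e * q)) *
           (\<integral>\<^sup>+x\<in>-E. ennreal (\<delta> x powr (-((a + e) * q)) * dist x y powr (-((n - 2 - s) * q))
              * (dist x y + \<delta> x + \<delta> y) powr (-(-m * q))) \<partial>lborel)"
          using E by (intro nn_integral_cmult) measurable
        also have "\<dots> \<le> ennreal (C1 powr (q / p') * \<delta> y powr (e * q)) *
            ennreal (C2 * \<delta> y powr (n - (a + e) * q - (n - 2 - s) * q - (-m) * q))"
          by (intro mult_left_mono C2b yE) auto
        also have "\<dots> = ennreal (C1 powr (q / p') * C2 * (\<delta> y powr (e * q) * \<delta> y powr (- (e * q))))"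
          unfolding e2 using C2 by (simp add: mult_ac flip: ennreal_mult)
        also have "\<delta> y powr (e * q) * \<delta> y powr (- (e * q)) = 1"
          using \<delta>pos[OF yE] by (simp flip: powr_add)
        finally show ?thesis by (simp add: D_def)
      qed
      show "ennreal (U x * \<delta> x powr (-a)) \<le> (\<integral>\<^sup>+y. ennreal (A x y * B x y * g y) \<partial>lborel)" if x: "x \<in> -E" for x
      proof -
        have "ennreal (U x * \<delta> x powr (-a)) = ennreal (\<delta> x powr (-a)) * ennreal (U x)"
          using U0 by (simp add: ennreal_mult mult.commute)
        also have "\<dots> \<le> ennreal (\<delta> x powr (-a)) * (\<integral>\<^sup>+y. ennreal (dist x y powr (2 - n) * f y) \<partial>lborel)"
          by (intro mult_left_mono U) auto
        also have "\<dots> = (\<integral>\<^sup>+y. ennreal (\<delta> x powr (-a) * (dist x y powr (2 - n) * f y)) \<partial>lborel)"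
          using f by (subst nn_integral_cmult[symmetric]) (auto simp: ennreal_mult)
        also have "\<dots> = (\<integral>\<^sup>+y. ennreal (A x y * B x y * g y) \<partial>lborel)"
        proof (rule nn_integral_cong_AE)
          show "AE y in lborel. ennreal (\<delta> x powr (-a) * (dist x y powr (2 - n) * f y)) = ennreal (A x y * B x y * g y)"
            using AE_not_in[OF null]
          proof eventually_elim
            case (elim y)
            have M: "dist x y + \<delta> x + \<delta> y > 0"
              using \<delta>pos[of x] x \<delta>nn[of y] by (intro add_pos_nonneg add_nonneg_pos) auto
            have 1: "dist x y powr (-s) * dist x y powr (-(n - 2 - s)) = dist x y powr (2 - n)"
              by (simp flip: powr_add)
            have 2: "(dist x y + \<delta> x + \<delta> y) powr (-m) * (dist x y + \<delta> x + \<delta> y) powr m = 1"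
              using M by (simp flip: powr_add)
            have 3: "\<delta> y powr (a - 1 - e) * \<delta> y powr e * \<delta> y powr (1 - a) = 1"
              using \<delta>pos[OF elim] by (simp flip: powr_add)
            have "A x y * B x y * g y = \<delta> x powr (-a) * (dist x y powr (-s) * dist x y powr (-(n - 2 - s))) *
               ((dist x y + \<delta> x + \<delta> y) powr (-m) * (dist x y + \<delta> x + \<delta> y) powr m) *
               (\<delta> y powr (a - 1 - e) * \<delta> y powr e * \<delta> y powr (1 - a)) * f y"
              unfolding A_def B_def g_def by (simp add: mult_ac)
            also have "\<dots> = \<delta> x powr (-a) * (dist x y powr (2 - n) * f y)"
              unfolding 1 2 3 by simp
            finally show ?case by simp
          qed
        qed
        finally show ?thesis .
      qed
    qed (use p q D X f U0 in \<open>auto simp: A_def B_def g_def\<close>)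
    then show "(\<integral>\<^sup>+x\<in>-E. ennreal ((U x * infdist x E powr (-a)) powr q) \<partial>lborel) \<le> ennreal (D * X powr (q / p))"
      by (simp add: \<delta>_def)
  qed
qed

section \<open>From ray integrals to the Riesz potential\<close>

lemma nn_integral_lborel_scaleR:
  fixes F :: "'a::euclidean_space \<Rightarrow> ennreal"
  assumes [measurable]: "F \<in> borel_measurable borel" and t: "t > 0"
  shows "(\<integral>\<^sup>+h. F (t *\<^sub>R h) \<partial>lborel) = ennreal (t powr (- real DIM('a))) * (\<integral>\<^sup>+y. F y \<partial>lborel)"
proof -
  have "(\<integral>\<^sup>+y. F y \<partial>lborel) = ennreal (t ^ DIM('a)) * (\<integral>\<^sup>+h. F (t *\<^sub>R h) \<partial>lborel)"
    using t by (subst lborel_affine[of t 0])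
      (auto simp: nn_integral_density nn_integral_distr nn_integral_cmult)
  moreover have "ennreal (t powr (- real DIM('a))) * ennreal (t ^ DIM('a)) = 1"
    using t by (simp add: powr_minus powr_realpow flip: ennreal_mult)
  ultimately show ?thesis by (simp flip: mult.assoc)
qed

lemma nn_integral_lborel_translate:
  fixes F :: "'a::euclidean_space \<Rightarrow> ennreal"
  assumes [measurable]: "F \<in> borel_measurable borel"
  shows "(\<integral>\<^sup>+y. F (x + y) \<partial>lborel) = (\<integral>\<^sup>+y. F y \<partial>lborel)"
  by (subst (2) lborel_distr_plus[of x, symmetric]) (simp add: nn_integral_distr)

lemma nn_integral_powr_tail:
  fixes n b :: real
  assumes "n > 0" "b > 0"
  shows "(\<integral>\<^sup>+t\<in>{b..}. ennreal (t powr (- n - 1)) \<partial>lborel) = ennreal (b powr (- n) / n)"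
proof -
  have "(\<integral>\<^sup>+t\<in>{b..}. ennreal (t powr (- n - 1)) \<partial>lborel) = ennreal (0 - (- (b powr (- n)) / n))"
  proof (rule nn_integral_FTC_atLeast[where F = "\<lambda>t. - (t powr (- n)) / n"])
    show "((\<lambda>t. - (t powr (- n)) / n) has_real_derivative x powr (- n - 1)) (at x)" if "b \<le> x" for x
      using that assms by (auto intro!: derivative_eq_intros simp: field_simps powr_diff)
    show "((\<lambda>t. - (t powr (- n)) / n) \<longlongrightarrow> 0) at_top"
      using assms tendsto_divide[OF tendsto_minus[OF tendsto_neg_powr[of "- n", OF _ filterlim_ident]] tendsto_const[of n]]
      by simp
  qed auto
  then show ?thesis by simp
qed

text \<open>Integrating the hypothesis over all \<open>h\<close> in the unit ball replaces polar coordinates.  The substitution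
  \<open>y = t h\<close> for fixed \<open>t\<close> leaves the factor \<open>t^(-n - 1)\<close> on \<open>{t > |y|}\<close>, whose integral is \<open>|y|^(-n) / n\<close>.\<close>

lemma average_ray_integrals_le_potential:
  fixes f :: "'a::euclidean_space \<Rightarrow> real" and x :: 'a
  defines "n \<equiv> real DIM('a)"
  assumes [measurable]: "f \<in> borel_measurable borel" and f: "\<And>y. f y \<ge> 0" and c: "c \<ge> 0"
    and ray: "\<And>h. h \<noteq> 0 \<Longrightarrow> ennreal c \<le> (\<integral>\<^sup>+t\<in>{0..}. ennreal (t * (norm h)\<^sup>2 * f (x + t *\<^sub>R h)) \<partial>lborel)"
  shows "ennreal (n * unit_ball_vol n * c) \<le> (\<integral>\<^sup>+y. ennreal (dist x y powr (2 - n) * f y) \<partial>lborel)"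
proof -
  have n: "n > 0" by (simp add: n_def)
  define G where "G t h = ennreal (t * (norm h)\<^sup>2 * f (x + t *\<^sub>R h)) * (if 0 < t \<and> norm h < 1 then 1 else 0)" for t and h :: 'a
  have [measurable]: "(\<lambda>(h, t). G t h) \<in> borel_measurable (borel \<Otimes>\<^sub>M borel)" unfolding G_def by measurable
  have "ennreal (unit_ball_vol n * c) = (\<integral>\<^sup>+h. ennreal c * indicator (ball (0::'a) 1) h \<partial>lborel)"
    using c by (simp add: nn_integral_cmult_indicator emeasure_ball n_def ennreal_mult mult.commute)
  also have "\<dots> \<le> (\<integral>\<^sup>+h. \<integral>\<^sup>+t. G t h \<partial>lborel \<partial>lborel)"
  proof (rule nn_integral_mono_AE)
    have "AE h in lborel. h \<noteq> (0::'a)" by (rule AE_lborel_singleton)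
    then show "AE h in lborel. ennreal c * indicator (ball (0::'a) 1) h \<le> (\<integral>\<^sup>+t. G t h \<partial>lborel)"
    proof eventually_elim
      case (elim h)
      show ?case
      proof (cases "norm h < 1")
        case True
        have "ennreal c \<le> (\<integral>\<^sup>+t\<in>{0..}. ennreal (t * (norm h)\<^sup>2 * f (x + t *\<^sub>R h)) \<partial>lborel)"
          using ray elim by blast
        also have "\<dots> = (\<integral>\<^sup>+t. G t h \<partial>lborel)"
          using True by (intro nn_integral_cong) (auto simp: G_def split: split_indicator)
        finally show ?thesis using True by simp
      qed simp
    qed
  qed
  also have "\<dots> = (\<integral>\<^sup>+t. \<integral>\<^sup>+h. G t h \<partial>lborel \<partial>lborel)"
    by (intro lborel_pair.Fubini') measurable
  also have "\<dots> = (\<integral>\<^sup>+t. \<integral>\<^sup>+y. ennreal ((norm y)\<^sup>2 * f (x + y)) * (ennreal (t powr (- n - 1)) * indicator {norm y<..} t) \<partial>lborel \<partial>lborel)"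
  proof (rule nn_integral_cong)
    fix t :: real
    show "(\<integral>\<^sup>+h. G t h \<partial>lborel) = (\<integral>\<^sup>+y. ennreal ((norm y)\<^sup>2 * f (x + y)) * (ennreal (t powr (- n - 1)) * indicator {norm y<..} t) \<partial>lborel)"
    proof (cases "t > 0")
      case False
      then have "indicator {norm y<..} t = (0::ennreal)" for y :: 'a
        using order.strict_trans1[OF norm_ge_zero[of y], of t] by (auto split: split_indicator)
      then show ?thesis using False by (simp add: G_def)
    next
      case True
      define F where "F y = ennreal ((norm y)\<^sup>2 / t * f (x + y)) * (if norm y < t then 1 else 0)" for y
      have [measurable]: "F \<in> borel_measurable borel" unfolding F_def by measurable
      have "G t h = F (t *\<^sub>R h)" for h
        using True by (auto simp: G_def F_def power2_eq_square mult_ac)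
      then have "(\<integral>\<^sup>+h. G t h \<partial>lborel) = ennreal (t powr (- n)) * (\<integral>\<^sup>+y. F y \<partial>lborel)"
        using nn_integral_lborel_scaleR[of F t] True by (simp add: n_def)
      also have "\<dots> = (\<integral>\<^sup>+y. ennreal (t powr (- n)) * F y \<partial>lborel)"
        by (rule nn_integral_cmult[symmetric]) measurable
      also have "\<dots> = (\<integral>\<^sup>+y. ennreal ((norm y)\<^sup>2 * f (x + y)) * (ennreal (t powr (- n - 1)) * indicator {norm y<..} t) \<partial>lborel)"
        using True f by (intro nn_integral_cong)
          (auto simp: F_def powr_diff mult_ac split: split_indicator simp flip: ennreal_mult)
      finally show ?thesis .
    qed
  qed
  also have "\<dots> = (\<integral>\<^sup>+y. \<integral>\<^sup>+t. ennreal ((norm y)\<^sup>2 * f (x + y)) * (ennreal (t powr (- n - 1)) * indicator {norm y<..} t) \<partial>lborel \<partial>lborel)"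
    unfolding indicator_def of_bool_def greaterThan_iff by (intro lborel_pair.Fubini'[symmetric]) measurable
  also have "\<dots> \<le> (\<integral>\<^sup>+y. ennreal (1 / n) * ennreal (dist x (x + y) powr (2 - n) * f (x + y)) \<partial>lborel)"
  proof (intro nn_integral_mono)
    fix y :: 'a
    show "(\<integral>\<^sup>+t. ennreal ((norm y)\<^sup>2 * f (x + y)) * (ennreal (t powr (- n - 1)) * indicator {norm y<..} t) \<partial>lborel)
       \<le> ennreal (1 / n) * ennreal (dist x (x + y) powr (2 - n) * f (x + y))"
    proof (cases "y = 0")
      case False
      have "(\<integral>\<^sup>+t. ennreal ((norm y)\<^sup>2 * f (x + y)) * (ennreal (t powr (- n - 1)) * indicator {norm y<..} t) \<partial>lborel)
        \<le> (\<integral>\<^sup>+t. ennreal ((norm y)\<^sup>2 * f (x + y)) * (ennreal (t powr (- n - 1)) * indicator {norm y..} t) \<partial>lborel)"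
        by (intro nn_integral_mono mult_left_mono) (auto split: split_indicator)
      also have "\<dots> = ennreal ((norm y)\<^sup>2 * f (x + y)) * ennreal (norm y powr (- n) / n)"
        using nn_integral_powr_tail[of n "norm y"] n False by (subst nn_integral_cmult) auto
      also have "\<dots> = ennreal (1 / n) * ennreal (dist x (x + y) powr (2 - n) * f (x + y))"
      proof -
        have "norm y powr (2 - n) = (norm y)\<^sup>2 * norm y powr (- n)"
          using False powr_add[of "norm y" 2 "- n"] by (simp add: powr_realpow)
        then show ?thesis
          using f n by (simp add: dist_norm mult_ac flip: ennreal_mult)
      qed
      finally show ?thesis .
    qed simp
  qed
  also have "\<dots> = ennreal (1 / n) * (\<integral>\<^sup>+y. ennreal (dist x (x + y) powr (2 - n) * f (x + y)) \<partial>lborel)"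
    by (intro nn_integral_cmult) measurable
  also have "(\<integral>\<^sup>+y. ennreal (dist x (x + y) powr (2 - n) * f (x + y)) \<partial>lborel) = (\<integral>\<^sup>+y. ennreal (dist x y powr (2 - n) * f y) \<partial>lborel)"
    by (intro nn_integral_lborel_translate) measurable
  finally have "ennreal n * ennreal (unit_ball_vol n * c)
     \<le> ennreal n * (ennreal (1 / n) * (\<integral>\<^sup>+y. ennreal (dist x y powr (2 - n) * f y) \<partial>lborel))"
    by (intro mult_left_mono) auto
  also have "\<dots> = (\<integral>\<^sup>+y. ennreal (dist x y powr (2 - n) * f y) \<partial>lborel)"
    using n by (simp flip: mult.assoc ennreal_mult)
  finally show ?thesis using n c by (simp add: mult.assoc flip: ennreal_mult)
qed

section \<open>Derivatives of smooth functions along rays\<close>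

text \<open>The coordinates are switched on one at a time.  Adding the coordinate \<open>i\<close> changes \<open>u\<close> by an increment along an axis, which the
  mean value inequality compares with \<open>h\<^sub>i\<close> times the partial derivative at the base point.\<close>

lemma has_derivative_of_continuous_partials:
  fixes u :: "real^'n::finite \<Rightarrow> real"
  assumes P: "\<And>i x. ((\<lambda>t. u (x + t *\<^sub>R axis i 1)) has_real_derivative P i x) (at 0)"
    and cont: "\<And>i. continuous_on UNIV (P i)"
  shows "(u has_derivative (\<lambda>h. \<Sum>i\<in>UNIV. h $ i * P i x)) (at x)"
proof -
  define pr where "pr S h = (\<Sum>i\<in>S. h $ i *\<^sub>R axis i (1::real))" for S and h :: "real^'n"
  have line: "((\<lambda>t. u (y + t *\<^sub>R axis i 1)) has_real_derivative P i (y + t *\<^sub>R axis i 1)) (at t)" for i y t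
    using P[of "y + t *\<^sub>R axis i 1" i] DERIV_shift[of "\<lambda>t. u (y + t *\<^sub>R axis i 1)" _ 0 t]
    by (simp add: scaleR_add_left add_ac)
  have "((\<lambda>h. u (x + pr S h)) has_derivative (\<lambda>h. \<Sum>i\<in>S. h $ i * P i x)) (at 0)" if "finite S" for S
    using that
  proof (induction S)
    case empty
    show ?case by (simp add: pr_def)
  next
    case (insert i S)
    define W where "W h = u (x + pr S h + h $ i *\<^sub>R axis i 1) - u (x + pr S h)" for h
    have pr0: "pr S 0 = 0" by (simp add: pr_def)
    have "(W has_derivative (\<lambda>h. h $ i * P i x)) (at 0)"
      unfolding has_derivative_at_alt
    proof (intro conjI allI impI)
      show "bounded_linear (\<lambda>h. h $ i * P i x)"
        by (intro bounded_linear_mult_const bounded_linear_vec_nth)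
      fix e :: real assume e: "e > 0"
      have "continuous (at x) (P i)" using cont[of i] by (simp add: continuous_on_eq_continuous_at)
      then obtain d where d: "d > 0" "\<And>y. dist y x < d \<Longrightarrow> dist (P i y) (P i x) < e"
        using e unfolding continuous_at_eps_delta by blast
      have "continuous (at 0) (\<lambda>h. norm (pr S h) + \<bar>h $ i\<bar>)"
        unfolding pr_def by (intro continuous_intros)
      then obtain d' where d': "d' > 0" "\<And>h. dist h 0 < d' \<Longrightarrow>
          dist (norm (pr S h) + \<bar>h $ i\<bar>) (norm (pr S 0) + \<bar>(0 :: real^'n) $ i\<bar>) < d"
        using d(1) unfolding continuous_at_eps_delta by blast
      show "\<exists>d>0. \<forall>y. norm (y - 0) < d \<longrightarrow> norm (W y - W 0 - (y - 0) $ i * P i x) \<le> e * norm (y - 0)"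
      proof (intro exI[of _ d'] conjI allI impI d')
        fix h :: "real^'n" assume "norm (h - 0) < d'"
        then have hd: "norm (pr S h) + \<bar>h $ i\<bar> < d" using d'(2)[of h] by (simp add: pr0 dist_real_def)
        define \<phi> where "\<phi> t = u (x + pr S h + t *\<^sub>R axis i 1) - t * P i x" for t
        have "norm (\<phi> (h $ i) - \<phi> 0) \<le> e * norm (h $ i - 0)"
        proof (rule field_differentiable_bound[of "closed_segment 0 (h $ i)" \<phi>])
          fix t assume t: "t \<in> closed_segment 0 (h $ i)"
          show "(\<phi> has_field_derivative (P i (x + pr S h + t *\<^sub>R axis i 1) - P i x)) (at t within closed_segment 0 (h $ i))"
            unfolding \<phi>_def
            by (rule DERIV_subset[OF DERIV_diff[OF line] subset_UNIV]) (auto intro!: derivative_eq_intros)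
          have "\<bar>t\<bar> \<le> \<bar>h $ i\<bar>" using t by (auto simp: closed_segment_eq_real_ivl split: if_splits)
          then have "dist (x + pr S h + t *\<^sub>R axis i 1) x < d"
            using hd norm_triangle_ineq[of "pr S h" "t *\<^sub>R axis i 1"] by (simp add: dist_norm add.assoc norm_axis_1)
          from d(2)[OF this] show "norm (P i (x + pr S h + t *\<^sub>R axis i 1) - P i x) \<le> e"
            by (simp add: dist_norm)
        qed auto
        moreover have "W h - W 0 - (h - 0) $ i * P i x = \<phi> (h $ i) - \<phi> 0"
          by (simp add: W_def \<phi>_def pr0)
        moreover have "e * \<bar>h $ i\<bar> \<le> e * norm h" using e component_le_norm_cart[of h i] by simp
        ultimately show "norm (W h - W 0 - (h - 0) $ i * P i x) \<le> e * norm (h - 0)" by simp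
      qed
    qed
    from has_derivative_add[OF insert.IH this]
    have "((\<lambda>h. u (x + pr S h) + W h) has_derivative (\<lambda>h. (\<Sum>i\<in>S. h $ i * P i x) + h $ i * P i x)) (at 0)" .
    moreover have "(\<lambda>h. u (x + pr S h) + W h) = (\<lambda>h. u (x + pr (insert i S) h))"
      using insert.hyps by (auto simp: W_def pr_def add_ac)
    ultimately show ?case using insert.hyps by (simp add: add.commute)
  qed
  from this[of UNIV] have "((\<lambda>h. u (x + h)) has_derivative (\<lambda>h. \<Sum>i\<in>UNIV. h $ i * P i x)) (at 0)"
    by (simp add: pr_def basis_expansion flip: scalar_mult_eq_scaleR)
  then show ?thesis by (simp add: has_derivative_at)
qed

lemma smooth_has_derivative:
  assumes "smooth u"
  shows "(foldr partial is u has_derivative (\<lambda>h. \<Sum>i\<in>UNIV. h $ i * partial i (foldr partial is u) x)) (at x)"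
proof (rule has_derivative_of_continuous_partials)
  fix i x
  show "((\<lambda>t. foldr partial is u (x + t *\<^sub>R axis i 1)) has_real_derivative partial i (foldr partial is u) x) (at 0)"
    unfolding partial_def[of i "foldr partial is u"]
    using assms unfolding smooth_def by (blast intro: field_differentiable_derivI)
  have "continuous_on UNIV (foldr partial (i # is) u)"
    using assms unfolding smooth_def by blast
  then show "continuous_on UNIV (partial i (foldr partial is u))" by simp
qed

lemma smooth_line_derivative:
  assumes "smooth u"
  shows "((\<lambda>t. foldr partial is u (x + t *\<^sub>R h)) has_real_derivative
    (\<Sum>i\<in>UNIV. h $ i * partial i (foldr partial is u) (x + t *\<^sub>R h))) (at t)"
proof -
  have "((\<lambda>t. x + t *\<^sub>R h) has_derivative (\<lambda>s. s *\<^sub>R h)) (at t)"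
    by (auto intro!: derivative_eq_intros)
  from has_derivative_compose[OF this smooth_has_derivative[OF assms, of "is"]]
  show ?thesis
    unfolding has_field_derivative_def
    by (rule has_derivative_eq_rhs) (simp add: fun_eq_iff sum_distrib_left mult_ac)
qed

lemma continuous_on_hessian_norm:
  assumes "smooth u"
  shows "continuous_on UNIV (hessian_norm u)"
proof -
  have "continuous_on UNIV (partial i (partial j u))" for i j
    using assms[unfolded smooth_def, rule_format, of "[i, j]"] by simp
  then show ?thesis
    unfolding hessian_norm_def by (intro continuous_intros)
qed

text \<open>Cauchy-Schwarz in the space of matrices.\<close>

lemma hessian_quadratic_form_bound:
  fixes h :: "real^'n"
  shows "\<bar>\<Sum>i\<in>UNIV. h $ i * (\<Sum>j\<in>UNIV. h $ j * partial j (partial i u) y)\<bar> \<le> (norm h)\<^sup>2 * hessian_norm u y"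
proof -
  let ?H = "\<lambda>(i, j). partial i (partial j u) y" and ?K = "\<lambda>(i, j). h $ j * h $ i"
  have "(\<Sum>i\<in>UNIV. h $ i * (\<Sum>j\<in>UNIV. h $ j * partial j (partial i u) y))
     = (\<Sum>j\<in>UNIV. \<Sum>i\<in>UNIV. h $ i * (h $ j * partial j (partial i u) y))"
    unfolding sum_distrib_left by (rule sum.swap)
  also have "\<dots> = (\<Sum>z\<in>UNIV. ?K z * ?H z)"
    by (simp add: sum.cartesian_product mult_ac case_prod_beta)
  finally have "\<bar>\<Sum>i\<in>UNIV. h $ i * (\<Sum>j\<in>UNIV. h $ j * partial j (partial i u) y)\<bar> \<le> (\<Sum>z\<in>UNIV. \<bar>?K z\<bar> * \<bar>?H z\<bar>)"
    by (simp only: abs_mult[symmetric] sum_abs)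
  also have "\<dots> \<le> L2_set ?K UNIV * L2_set ?H UNIV"
    by (rule L2_set_mult_ineq)
  also have "L2_set ?H UNIV = hessian_norm u y"
    unfolding L2_set_def hessian_norm_def by (simp add: sum.cartesian_product case_prod_beta)
  also have "L2_set ?K UNIV = (norm h)\<^sup>2"
  proof -
    have "(\<Sum>z\<in>UNIV. (?K z)\<^sup>2) = (\<Sum>i\<in>UNIV. \<Sum>j\<in>UNIV. (h $ j)\<^sup>2 * (h $ i)\<^sup>2)"
      by (simp add: sum.cartesian_product case_prod_beta power_mult_distrib)
    also have "\<dots> = (\<Sum>j\<in>UNIV. (h $ j)\<^sup>2) * (\<Sum>i\<in>UNIV. (h $ i)\<^sup>2)"
      by (simp add: sum_distrib_left sum_distrib_right)
    also have "\<dots> = ((norm h)\<^sup>2)\<^sup>2"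
      by (simp add: norm_vec_def L2_set_def sum_nonneg power2_eq_square)
    finally have eq: "(\<Sum>z\<in>UNIV. (?K z)\<^sup>2) = ((norm h)\<^sup>2)\<^sup>2" .
    show ?thesis unfolding L2_set_def eq by (simp only: real_sqrt_abs abs_power2)
  qed
  finally show ?thesis .
qed

text \<open>For \<open>\<phi>(t) = u(x + t h)\<close> the function \<open>t \<phi>'(t) - \<phi>(t)\<close> is a primitive of \<open>t \<phi>''(t)\<close>, vanishes for large
  \<open>t\<close> by compact support, and equals \<open>-u(x)\<close> at \<open>t = 0\<close>.\<close>

lemma test_function_ray_bound:
  fixes u :: "real^'n::finite \<Rightarrow> real"
  assumes u: "test_function u" and h: "h \<noteq> 0"
  shows "ennreal \<bar>u x\<bar> \<le> (\<integral>\<^sup>+t\<in>{0..}. ennreal (t * (norm h)\<^sup>2 * hessian_norm u (x + t *\<^sub>R h)) \<partial>lborel)"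
proof -
  have sm: "smooth u" using u by (simp add: test_function_def)
  have "bounded (closure {x. u x \<noteq> 0})" using u by (simp add: test_function_def compact_imp_bounded)
  then have "bounded {x. u x \<noteq> 0}" by (rule bounded_subset) (rule closure_subset)
  then obtain R where R: "\<And>y. u y \<noteq> 0 \<Longrightarrow> norm y \<le> R"
    unfolding bounded_iff by auto
  define \<phi> where "\<phi> t = u (x + t *\<^sub>R h)" for t
  define \<phi>1 where "\<phi>1 t = (\<Sum>i\<in>UNIV. h $ i * partial i u (x + t *\<^sub>R h))" for t
  define \<phi>2 where "\<phi>2 t = (\<Sum>i\<in>UNIV. h $ i * (\<Sum>j\<in>UNIV. h $ j * partial j (partial i u) (x + t *\<^sub>R h)))" for t
  define T where "T = (\<bar>R\<bar> + norm x + 1) / norm h"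
  have T: "T > 0" using h by (auto simp: T_def intro!: divide_pos_pos add_nonneg_pos)
  have far: "\<phi> t = 0" if "T \<le> t" for t
  proof (rule ccontr)
    assume "\<phi> t \<noteq> 0"
    then have "norm (x + t *\<^sub>R h) \<le> R" using R by (simp add: \<phi>_def)
    moreover have "norm (t *\<^sub>R h) \<le> norm (x + t *\<^sub>R h) + norm x"
      using norm_triangle_ineq4[of "x + t *\<^sub>R h" x] by simp
    moreover have "T * norm h \<le> norm (t *\<^sub>R h)" using that T by (simp add: mult_right_mono)
    ultimately show False using h by (simp add: T_def)
  qed
  have d1: "(\<phi> has_real_derivative \<phi>1 t) (at t)" for t
    using smooth_line_derivative[OF sm, of "[]" x h t] by (simp add: \<phi>_def[abs_def] \<phi>1_def)
  have d2: "(\<phi>1 has_real_derivative \<phi>2 t) (at t)" for t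
    unfolding \<phi>1_def[abs_def] \<phi>2_def
  proof (intro DERIV_sum DERIV_cmult)
    fix i
    show "((\<lambda>t. partial i u (x + t *\<^sub>R h)) has_real_derivative (\<Sum>j\<in>UNIV. h $ j * partial j (partial i u) (x + t *\<^sub>R h))) (at t)"
      using smooth_line_derivative[OF sm, of "[i]" x h t] by simp
  qed
  \<comment> \<open>Beyond T the function vanishes identically, hence so does its derivative at an interior point of that ray.\<close>
  have "\<phi>1 (T + 1) = 0"
  proof (rule DERIV_unique[OF d1])
    have "eventually (\<lambda>t. t > T) (nhds (T + 1))"
      using eventually_nhds_in_open[of "{T<..}" "T + 1"] by simp
    then have ev: "eventually (\<lambda>t. \<phi> t = 0) (nhds (T + 1))" by eventually_elim (simp add: far)
    then show "(\<phi> has_real_derivative 0) (at (T + 1))" 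
      using DERIV_cong_ev[where g = "\<lambda>_. 0", OF refl ev refl, of 0] by simp
  qed
  define I where "I = integral {0..T+1} (\<lambda>t. t * (norm h)\<^sup>2 * hessian_norm u (x + t *\<^sub>R h))"
  have hc: "continuous_on UNIV (hessian_norm u)" by (rule continuous_on_hessian_norm[OF sm])
  have int: "(\<lambda>t. t * (norm h)\<^sup>2 * hessian_norm u (x + t *\<^sub>R h)) integrable_on {0..T+1}"
    by (intro integrable_continuous_real continuous_intros continuous_on_compose2[OF hc]) auto
  have ftc: "((\<lambda>t. t * \<phi>2 t) has_integral ((T + 1) * \<phi>1 (T + 1) - \<phi> (T + 1)) - (0 * \<phi>1 0 - \<phi> 0)) {0..T+1}"
  proof (rule fundamental_theorem_of_calculus)
    fix t
    have "((\<lambda>t. t * \<phi>1 t - \<phi> t) has_real_derivative t * \<phi>2 t) (at t)"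
      by (auto intro!: derivative_eq_intros d1 d2)
    then show "((\<lambda>t. t * \<phi>1 t - \<phi> t) has_vector_derivative t * \<phi>2 t) (at t within {0..T+1})"
      by (simp add: has_real_derivative_iff_has_vector_derivative has_vector_derivative_at_within)
  qed (use T in simp)
  then have ftc': "((\<lambda>t. t * \<phi>2 t) has_integral u x) {0..T+1}"
    using \<open>\<phi>1 (T + 1) = 0\<close> far[of "T + 1"] by (simp add: \<phi>_def)
  have "\<bar>u x\<bar> = norm (integral {0..T+1} (\<lambda>t. t * \<phi>2 t))" using ftc' by (simp add: integral_unique)
  also have "\<dots> \<le> I"
    unfolding I_def
  proof (rule integral_norm_bound_integral[OF has_integral_integrable[OF ftc'] int])
    fix t assume t: "t \<in> {0..T+1}"
    show "norm (t * \<phi>2 t) \<le> t * (norm h)\<^sup>2 * hessian_norm u (x + t *\<^sub>R h)"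
      using t hessian_quadratic_form_bound[of h u "x + t *\<^sub>R h"]
      by (auto simp: abs_mult \<phi>2_def mult.assoc intro!: mult_left_mono)
  qed
  finally have "ennreal \<bar>u x\<bar> \<le> ennreal I" by (rule ennreal_leI)
  also have "ennreal I = (\<integral>\<^sup>+t\<in>{0..T+1}. ennreal (t * (norm h)\<^sup>2 * hessian_norm u (x + t *\<^sub>R h)) \<partial>lborel)"
    unfolding I_def
    by (intro nn_integral_has_integral_lebesgue'[symmetric] integrable_integral int)
       (auto simp: hessian_norm_def sum_nonneg)
  also have "\<dots> \<le> (\<integral>\<^sup>+t\<in>{0..}. ennreal (t * (norm h)\<^sup>2 * hessian_norm u (x + t *\<^sub>R h)) \<partial>lborel)"
    by (intro nn_integral_mono mult_left_mono) (auto split: split_indicator)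
  finally show ?thesis .
qed

section \<open>Logarithms and the inequality\<close>

lemma mult_ln_le_of_bound:
  fixes w F \<theta> G :: real
  assumes "w \<ge> 0" "F > 0" "\<theta> > 0" "G > 0"
  shows "w * ln F \<le> (w * F powr \<theta> / G - w + w * ln G) / \<theta>"
proof -
  have "ln (F powr \<theta> / G) \<le> F powr \<theta> / G - 1"
    using assms by (intro ln_le_minus_one) auto
  then have "\<theta> * ln F \<le> F powr \<theta> / G - 1 + ln G"
    using assms by (simp add: ln_div ln_powr)
  then have "w * (\<theta> * ln F) \<le> w * (F powr \<theta> / G - 1 + ln G)"
    using assms by (intro mult_left_mono) auto
  then show ?thesis using assms by (simp add: field_simps)
qed

text \<open>The pointwise bound is integrated with all negative terms moved to the other side, so that only nonnegative
  integrals occur.  The positive part of \<open>w ln F\<close> has a finite integral; the negative part may have an infinite one, in which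
  case the left-hand side is \<open>-\<infinity>\<close>.\<close>

lemma ext_integral_mult_ln_le:
  fixes w F :: "'a \<Rightarrow> real"
  assumes [measurable]: "w \<in> borel_measurable M" "F \<in> borel_measurable M"
    and w: "\<And>x. w x \<ge> 0" and F: "\<And>x. w x \<noteq> 0 \<Longrightarrow> F x > 0"
    and one: "(\<integral>\<^sup>+x. ennreal (w x) \<partial>M) = 1"
    and \<theta>: "\<theta> > 0" and G: "G > 0" "(\<integral>\<^sup>+x. ennreal (w x * F x powr \<theta>) \<partial>M) \<le> ennreal G"
  shows "ext_integral M (\<lambda>x. w x * ln (F x)) \<le> ereal (ln G / \<theta>)"
proof -
  define L where "L = ln G / \<theta>"
  define f where "f x = w x * ln (F x)" for x
  have [measurable]: "f \<in> borel_measurable M" unfolding f_def by measurable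
  define P where "P = (\<integral>\<^sup>+x. ennreal (f x) \<partial>M)"
  define Q where "Q = (\<integral>\<^sup>+x. ennreal (- f x) \<partial>M)"
  define L1 where "L1 = max L 0"
  define L2 where "L2 = max (- L) 0"
  have L: "L1 \<ge> 0" "L2 \<ge> 0" "L = L1 - L2" by (auto simp: L1_def L2_def)
  \<comment> \<open>The constant L may have either sign; its positive and negative parts go to different sides.\<close>
  have pt: "f x + (1 / \<theta> + L2) * w x \<le> 1 / (\<theta> * G) * (w x * F x powr \<theta>) + L1 * w x" for x
  proof (cases "w x = 0")
    case True then show ?thesis by (simp add: f_def)
  next
    case False
    have "f x \<le> (w x * F x powr \<theta> / G - w x + w x * ln G) / \<theta>"
      unfolding f_def using mult_ln_le_of_bound[OF w F[OF False] \<theta> G(1)] .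
    also have "\<dots> = 1 / (\<theta> * G) * (w x * F x powr \<theta>) - 1 / \<theta> * w x + (L1 - L2) * w x"
      unfolding L(3)[symmetric] L_def using \<theta> G(1) by (simp add: field_simps)
    finally show ?thesis by (simp add: algebra_simps)
  qed
  have "P + ennreal (1 / \<theta> + L2) = (\<integral>\<^sup>+x. ennreal (f x) + ennreal (1 / \<theta> + L2) * ennreal (w x) \<partial>M)"
    unfolding P_def by (subst nn_integral_add) (auto simp: nn_integral_cmult one)
  also have "\<dots> \<le> (\<integral>\<^sup>+x. ennreal (1 / (\<theta> * G)) * ennreal (w x * F x powr \<theta>) + ennreal L1 * ennreal (w x) + ennreal (- f x) \<partial>M)"
  proof (intro nn_integral_mono)
    fix x
    have nn: "(1 / \<theta> + L2) * w x \<ge> 0" "1 / (\<theta> * G) * (w x * F x powr \<theta>) \<ge> 0" "L1 * w x \<ge> 0"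
      using L w \<theta> G by auto
    have "ennreal (f x) + ennreal ((1 / \<theta> + L2) * w x)
       = ennreal (max (f x) 0 + (1 / \<theta> + L2) * w x)"
      using nn by (subst ennreal_plus) (auto simp: max_def ennreal_neg)
    also have "\<dots> \<le> ennreal (1 / (\<theta> * G) * (w x * F x powr \<theta>) + L1 * w x + max (- f x) 0)"
      using pt[of x] nn by (intro ennreal_leI) (auto simp: max_def)
    also have "\<dots> = ennreal (1 / (\<theta> * G) * (w x * F x powr \<theta>)) + ennreal (L1 * w x) + ennreal (- f x)"
      using nn by (subst ennreal_plus, simp, simp, subst ennreal_plus) (auto simp: max_def ennreal_neg)
    finally show "ennreal (f x) + ennreal (1 / \<theta> + L2) * ennreal (w x)
       \<le> ennreal (1 / (\<theta> * G)) * ennreal (w x * F x powr \<theta>) + ennreal L1 * ennreal (w x) + ennreal (- f x)"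
      using L w \<theta> G by (simp only: ennreal_mult[symmetric] add_nonneg_nonneg mult_nonneg_nonneg
          divide_nonneg_nonneg zero_le_one less_imp_le powr_ge_zero)
  qed
  also have "\<dots> = ennreal (1 / (\<theta> * G)) * (\<integral>\<^sup>+x. ennreal (w x * F x powr \<theta>) \<partial>M) + ennreal L1 + Q"
    unfolding Q_def by (subst nn_integral_add, measurable, subst nn_integral_add) (auto simp: nn_integral_cmult one)
  also have "\<dots> \<le> ennreal (1 / (\<theta> * G)) * ennreal G + ennreal L1 + Q"
    by (intro add_mono mult_left_mono G) auto
  also have "\<dots> = ennreal (1 / \<theta> + L1) + Q"
    using \<theta> G L by (simp flip: ennreal_mult ennreal_plus)
  finally have main: "P + ennreal (1 / \<theta> + L2) \<le> ennreal (1 / \<theta> + L1) + Q" .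
  have "P \<le> (\<integral>\<^sup>+x. ennreal (1 / (\<theta> * G)) * ennreal (w x * F x powr \<theta>) + ennreal L1 * ennreal (w x) \<partial>M)"
    unfolding P_def
  proof (intro nn_integral_mono)
    fix x
    have "(1 / \<theta> + L2) * w x \<ge> 0" using L w \<theta> by simp
    then have "ennreal (f x) \<le> ennreal (1 / (\<theta> * G) * (w x * F x powr \<theta>) + L1 * w x)"
      using pt[of x] by (intro ennreal_leI) linarith
    also have "\<dots> = ennreal (1 / (\<theta> * G) * (w x * F x powr \<theta>)) + ennreal (L1 * w x)"
      using L w[of x] \<theta> G by (intro ennreal_plus) auto
    finally show "ennreal (f x) \<le> ennreal (1 / (\<theta> * G)) * ennreal (w x * F x powr \<theta>) + ennreal L1 * ennreal (w x)"
      using L w[of x] \<theta> G by (subst (1 2) ennreal_mult[symmetric]) auto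
  qed
  also have "\<dots> = ennreal (1 / (\<theta> * G)) * (\<integral>\<^sup>+x. ennreal (w x * F x powr \<theta>) \<partial>M) + ennreal L1"
    by (subst nn_integral_add) (auto simp: nn_integral_cmult one)
  also have "\<dots> \<le> ennreal (1 / (\<theta> * G)) * ennreal G + ennreal L1"
    by (intro add_mono mult_left_mono G) auto
  also have "\<dots> < \<infinity>" by (simp add: ennreal_mult_less_top)
  finally have Pfin: "P < \<infinity>" .
  have "enn2ereal P - enn2ereal Q \<le> ereal L"
  proof (cases "Q = \<infinity>")
    case True
    then show ?thesis using Pfin by (cases P) (auto simp: enn2ereal_ennreal)
  next
    case False
    then obtain q' where q': "Q = ennreal q'" "q' \<ge> 0" by (cases Q) auto
    from Pfin obtain p' where p': "P = ennreal p'" "p' \<ge> 0" by (cases P) auto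
    have "ennreal (p' + (1 / \<theta> + L2)) \<le> ennreal (1 / \<theta> + L1 + q')"
      using main p' q' L \<theta> by simp
    then have "p' + (1 / \<theta> + L2) \<le> 1 / \<theta> + L1 + q'"
      using p' q' L \<theta> by (subst (asm) ennreal_le_iff) auto
    then show ?thesis using p' q' L(3) by (simp add: enn2ereal_ennreal)
  qed
  then show ?thesis by (simp add: ext_integral_def P_def Q_def f_def L_def)
qed

theorem theorem1p4:
  fixes E :: "(real^'n) set" and N p d :: real
  assumes "N = real CARD('n)"
    and "N \<ge> 3"
    and "1 < p" and "p < N / 2"
    and "closed E" and "E \<noteq> {}"
    and "assouad_dim E = ereal d"
    and "d < N * (N - 2 * p) / (N - p)"
  shows "\<forall>a \<in> {1 - (N - d) * (p - 1) / p <..< (N - p) * (N - d) / (N * p)}. \<exists>C>0.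
    \<forall>u :: real^'n \<Rightarrow> real. test_function u \<longrightarrow>
      (\<integral>\<^sup>+x. ennreal (\<bar>u x\<bar> powr p / infdist x E powr (p * (a + 1))) \<partial>lborel) = 1 \<longrightarrow>
      ext_integral lborel
        (\<lambda>x. \<bar>u x\<bar> powr p / infdist x E powr (p * (a + 1)) *
             ln (infdist x E powr (N - p - p * a) * \<bar>u x\<bar> powr p))
      \<le> ereal (N / p) * ext_ln (ennreal C *
          (\<integral>\<^sup>+x. ennreal (hessian_norm u x powr p / infdist x E powr ((a - 1) * p)) \<partial>lborel))"
proof
  fix a assume "a \<in> {1 - (N - d) * (p - 1) / p <..< (N - p) * (N - d) / (N * p)}"
  then have a: "1 - (N - d) * (p - 1) / p < a" "a < (N - p) * (N - d) / (N * p)" by auto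
  have N: "real DIM(real^'n) = N" using assms(1) by simp
  have pN: "1 < p" "p < N" "p > 0" "N > 0" "N - p > 0" using assms(2-4) by auto
  define q where "q = N * p / (N - p)"
  \<comment> \<open>The power of the argument of the logarithm that turns the density into the q-th power of the Sobolev inequality.\<close>
  define \<theta> where "\<theta> = p / (N - p)"
  have q: "q > 0" "\<theta> > 0" "q = p + p * \<theta>" "q / p / \<theta> = N / p" "p / q = 1 / (q / p)"
    using pN by (simp_all add: q_def \<theta>_def field_simps)
  have aq: "a * q < N - d"
    using a(2) pN by (simp add: q_def field_simps)
  have ap: "(1 - a) * (p / (p - 1)) < N - d"
    using a(1) pN by (simp add: field_simps)
  \<comment> \<open>The Assouad dimension is an infimum, so some admissible exponent satisfies the two strict bounds.\<close>
  have "assouad_dim E < ereal (min (N - a * q) (N - (1 - a) * (p / (p - 1))))"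
    using aq ap assms(7) by simp
  then obtain l where l: "0 \<le> l" "assouad_admissible E l" "l < min (N - a * q) (N - (1 - a) * (p / (p - 1)))"
    unfolding assouad_dim_def INF_less_iff by auto
  obtain C0 where C0: "C0 > 0" and pot: "\<And>f U X. f \<in> borel_measurable borel \<Longrightarrow> (\<And>y. f y \<ge> 0) \<Longrightarrow> (\<And>x. U x \<ge> 0)
    \<Longrightarrow> X > 0 \<Longrightarrow> (\<integral>\<^sup>+y. ennreal (f y powr p / infdist y E powr ((a - 1) * p)) \<partial>lborel) \<le> ennreal X
    \<Longrightarrow> (\<And>x. ennreal (U x) \<le> (\<integral>\<^sup>+y. ennreal (dist x y powr (2 - N) * f y) \<partial>lborel))
    \<Longrightarrow> (\<integral>\<^sup>+x\<in>-E. ennreal ((U x * infdist x E powr (-a)) powr q) \<partial>lborel) \<le> ennreal (C0 * X powr (q / p))"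
    by (rule weighted_potential_bound[OF l(2) assms(5,6) l(1) pN(1), where a = a, unfolded N, folded q_def])
      (use pN l(3) in \<open>auto simp: q_def\<close>)
  define \<kappa> where "\<kappa> = N * unit_ball_vol N"
  have \<kappa>: "\<kappa> > 0" using pN by (simp add: \<kappa>_def)
  define K where "K = C0 / \<kappa> powr q"
  have K: "K > 0" using C0 \<kappa> by (simp add: K_def)
  define C where "C = K powr (p / q)"
  have C: "C > 0" using K by (simp add: C_def)
  show "\<exists>C>0. \<forall>u :: real^'n \<Rightarrow> real. test_function u \<longrightarrow>
      (\<integral>\<^sup>+x. ennreal (\<bar>u x\<bar> powr p / infdist x E powr (p * (a + 1))) \<partial>lborel) = 1 \<longrightarrow>
      ext_integral lborel
        (\<lambda>x. \<bar>u x\<bar> powr p / infdist x E powr (p * (a + 1)) *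
             ln (infdist x E powr (N - p - p * a) * \<bar>u x\<bar> powr p))
      \<le> ereal (N / p) * ext_ln (ennreal C *
          (\<integral>\<^sup>+x. ennreal (hessian_norm u x powr p / infdist x E powr ((a - 1) * p)) \<partial>lborel))"
  proof (intro exI[of _ C] conjI C allI impI)
    fix u :: "real^'n \<Rightarrow> real"
    assume u: "test_function u"
      and one: "(\<integral>\<^sup>+x. ennreal (\<bar>u x\<bar> powr p / infdist x E powr (p * (a + 1))) \<partial>lborel) = 1"
    let ?lhs = "ext_integral lborel
        (\<lambda>x. \<bar>u x\<bar> powr p / infdist x E powr (p * (a + 1)) *
             ln (infdist x E powr (N - p - p * a) * \<bar>u x\<bar> powr p))"
    define R where "R = (\<integral>\<^sup>+x. ennreal (hessian_norm u x powr p / infdist x E powr ((a - 1) * p)) \<partial>lborel)"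
    have sm: "smooth u" using u by (simp add: test_function_def)
    have [measurable]: "u \<in> borel_measurable borel"
      using sm[unfolded smooth_def, rule_format, of "[]"] by (intro borel_measurable_continuous_onI) simp
    have [measurable]: "hessian_norm u \<in> borel_measurable borel"
      by (intro borel_measurable_continuous_onI continuous_on_hessian_norm sm)
    have hnn: "hessian_norm u y \<ge> 0" for y by (simp add: hessian_norm_def sum_nonneg)
    have ray: "ennreal (\<kappa> * \<bar>u x\<bar>) \<le> (\<integral>\<^sup>+y. ennreal (dist x y powr (2 - N) * hessian_norm u y) \<partial>lborel)" for x
      using average_ray_integrals_le_potential[of "hessian_norm u" "\<bar>u x\<bar>" x, OF _ hnn _ test_function_ray_bound[OF u]]
      unfolding N by (simp add: \<kappa>_def)
    \<comment> \<open>The bound is stated for every positive X above the Hessian integral, so that the integral may also be zero.\<close>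
    have bound: "?lhs \<le> ereal (N / p * ln (C * X))" if X: "X > 0" "R \<le> ennreal X" for X
    proof -
      have "(\<integral>\<^sup>+x. ennreal (\<bar>u x\<bar> powr p / infdist x E powr (p * (a + 1)) * (infdist x E powr (N - p - p * a) * \<bar>u x\<bar> powr p) powr \<theta>) \<partial>lborel)
        = (\<integral>\<^sup>+x. ennreal (1 / \<kappa> powr q) * (ennreal ((\<kappa> * \<bar>u x\<bar> * infdist x E powr (-a)) powr q) * indicator (-E) x) \<partial>lborel)"
      proof (rule nn_integral_cong)
        fix x
        show "ennreal (\<bar>u x\<bar> powr p / infdist x E powr (p * (a + 1)) * (infdist x E powr (N - p - p * a) * \<bar>u x\<bar> powr p) powr \<theta>)
          = ennreal (1 / \<kappa> powr q) * (ennreal ((\<kappa> * \<bar>u x\<bar> * infdist x E powr (-a)) powr q) * indicator (-E) x)"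
        proof (cases "x \<in> E")
          case True
          then show ?thesis by simp
        next
          case False
          have e1: "-(p * (a + 1)) + (N - p - p * a) * \<theta> = - a * q"
          proof -
            have "(N - p) * \<theta> = p" using pN by (simp add: \<theta>_def)
            then show ?thesis unfolding q(3) by (simp add: algebra_simps)
          qed
          have "\<bar>u x\<bar> powr p / infdist x E powr (p * (a + 1)) * (infdist x E powr (N - p - p * a) * \<bar>u x\<bar> powr p) powr \<theta>
            = (\<bar>u x\<bar> powr p * \<bar>u x\<bar> powr (p * \<theta>)) * (infdist x E powr (-(p * (a + 1))) * infdist x E powr ((N - p - p * a) * \<theta>))"
            unfolding powr_mult powr_powr powr_minus_divide by simp
          also have "\<dots> = \<bar>u x\<bar> powr q * infdist x E powr (- a * q)"
            unfolding powr_add[symmetric] e1 q(3)[symmetric] ..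
          also have "\<dots> = 1 / \<kappa> powr q * (\<kappa> * \<bar>u x\<bar> * infdist x E powr (-a)) powr q"
            using \<kappa> unfolding powr_mult powr_powr by simp
          finally show ?thesis using False by (simp flip: ennreal_mult)
        qed
      qed
      also have "\<dots> = ennreal (1 / \<kappa> powr q) * (\<integral>\<^sup>+x\<in>-E. ennreal ((\<kappa> * \<bar>u x\<bar> * infdist x E powr (-a)) powr q) \<partial>lborel)"
        using assms(5) by (intro nn_integral_cmult) measurable
      also have "\<dots> \<le> ennreal (1 / \<kappa> powr q) * ennreal (C0 * X powr (q / p))"
        using X \<kappa> hnn ray by (intro mult_left_mono pot[of "hessian_norm u"]) (auto simp: R_def)
      also have "\<dots> = ennreal (K * X powr (q / p))"
        using C0 by (simp add: K_def flip: ennreal_mult)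
      finally have "?lhs \<le> ereal (ln (K * X powr (q / p)) / \<theta>)"
        using one K X q infdist_nonneg[of _ E]
        by (intro ext_integral_mult_ln_le) (auto simp: less_le)
      also have "ln (K * X powr (q / p)) / \<theta> = N / p * ln (C * X)"
      proof -
        have "ln (K * X powr (q / p)) = q / p * (p / q * ln K + ln X)"
          using K X q(1) pN(3) by (simp add: ln_mult ln_powr ring_distribs)
        also have "p / q * ln K + ln X = ln (C * X)"
          using K X C by (simp add: C_def ln_mult ln_powr)
        finally show ?thesis unfolding q(4)[symmetric] by simp
      qed
      finally show ?thesis .
    qed
    show "?lhs \<le> ereal (N / p) * ext_ln (ennreal C * (\<integral>\<^sup>+x. ennreal (hessian_norm u x powr p / infdist x E powr ((a - 1) * p)) \<partial>lborel))"
      unfolding R_def[symmetric]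
    proof (cases R)
      case top
      then show "?lhs \<le> ereal (N / p) * ext_ln (ennreal C * R)"
        using C pN by (simp add: ext_ln_def ennreal_mult_top)
    next
      case (real r)
      show "?lhs \<le> ereal (N / p) * ext_ln (ennreal C * R)"
      proof (cases "r = 0")
        case False
        with real have r: "r > 0" by simp
        then have "ext_ln (ennreal C * R) = ereal (ln (C * r))"
          using C real by (simp add: ext_ln_def flip: ennreal_mult)
        then show ?thesis using bound[OF r] real by simp
      next
        case True
        \<comment> \<open>A vanishing Hessian integral forces the left-hand side below every real number, since X is then arbitrarily small.\<close>
        have "?lhs \<le> ereal B" for B
        proof -
          have "?lhs \<le> ereal (N / p * ln (C * (exp (p * B / N) / C)))"
            using C real True by (intro bound) auto
          then show ?thesis using C pN by simp
        qed
        then have "?lhs = -\<infinity>" by (rule ereal_bot)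
        then show ?thesis by simp
      qed
    qed
  qed
qed

end
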